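(* Let $X$ be a locally finite tree, let $g,h\in\operatorname{Aut}(X)$, and suppose $\Gamma=\langle g,h\rangle$ is discrete, acts without inversions, and acts faithfully on its minimal subtree. Suppose $g$ is elliptic with fixed tree $T_g$, and $h$ is hyperbolic with translation length $l=\ell(h)$ and axis $A_h$, and let $d=d(T_g,A_h)$. Let $Y$ be the quotient graph of the minimal $\Gamma$-subtree by $\Gamma$. Then $Y$ has cyclomatic number $\mathrm{b}_1(Y)\le 1$; that is, $Y$ is either a tree or unicyclic. In addition, $Y$ is obtained by identifying edges of the $(l,d)$-tadpole graph $Y'$. Furthermore, if $Y$ is unicyclic, then the circuit in $Y$ is homotopic to the image of the circuit of $Y'$ under the edge identifications.
   Context: $X$ is a locally finite tree with $X/\operatorname{Aut}(X)$ finite. A tree automorphism is elliptic if it fixes a vertex, with fixed subtree $T_g$; it is hyperbolic if it is not elliptic and inverts no edge, and then its minimal displacement $\ell(h)>0$ is attained exactly on a bi-infinite geodesic $A_h$, its axis. A subgroup $\Gamma<\operatorname{Aut}(X)$ is discrete if the pointwise stabilizer in $\Gamma$ of some finite subtree is trivial. The minimal $\Gamma$-subtree is the union of the axes of all hyperbolic elements of $\Gamma$. The $(l,d)$-tadpole graph is a circuit of length $l$ with an attached path of length $d$ (sharing one vertex, the junction, with the circuit). Circuits of length 1 (loops) and 2 (double edges) are allowed. *)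

theory Defs
  imports
    "Graph_Theory.Bidirected_Digraph"
    "Graph_Theory.Digraph_Component"
    "HOL-Algebra.Group_Action"
    "HOL-Algebra.Generated_Groups"
begin

section \<open>Graphs with loops and multiple edges\<close>

text \<open>
  Graphs are graphs in the sense of Serre: a digraph \<open>G\<close> together with a fixed-point free
  involution \<open>r\<close> of its arcs which exchanges tail and head (locale \<^locale>\<open>bidirected_digraph\<close>).
  A geometric edge is a pair \<open>{a, r a}\<close>, so loops and multiple edges are allowed.
\<close>

text \<open>
  \<^const>\<open>pre_digraph.cycle\<close> forbids repeated vertices but admits the backtracking walk
  \<open>a, r a\<close> along a single edge that is not a loop; this is the only degenerate case to exclude.
  Circuits of length 1 (loops) and 2 (double edges) remain.
\<close>
definition circuit :: "('a, 'b) pre_digraph \<Rightarrow> ('b \<Rightarrow> 'b) \<Rightarrow> 'b awalk \<Rightarrow> bool" where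
  "circuit G r p \<longleftrightarrow> pre_digraph.cycle G p \<and> (\<forall>a. p \<noteq> [a, r a])"

definition serre_tree :: "('a, 'b) pre_digraph \<Rightarrow> ('b \<Rightarrow> 'b) \<Rightarrow> bool" where
  "serre_tree G r \<longleftrightarrow> bidirected_digraph G r \<and> connected G \<and> (\<nexists>p. circuit G r p)"

text \<open>
  A circuit is counted as a subgraph, that is, irrespective of its starting point and direction.
\<close>
definition unicyclic :: "('a, 'b) pre_digraph \<Rightarrow> ('b \<Rightarrow> 'b) \<Rightarrow> bool" where
  "unicyclic G r \<longleftrightarrow> bidirected_digraph G r \<and> connected G \<and>
     (\<exists>!C. \<exists>p. circuit G r p \<and> C = set p \<union> r ` set p)"

text \<open>
  Number of edges minus number of vertices plus number of components, for finite graphs.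
  Strong components and components coincide because the arcs come in opposite pairs.
\<close>
definition cyclomatic_number :: "('a, 'b) pre_digraph \<Rightarrow> ('b \<Rightarrow> 'b) \<Rightarrow> int" where
  "cyclomatic_number G r =
     int (card ((\<lambda>a. {a, r a}) ` arcs G)) - int (card (verts G))
       + int (card (pre_digraph.sccs_verts G))"

text \<open>
  Free homotopy of closed walks \<open>(u, p)\<close> based at \<open>u\<close>: insertion and deletion of
  backtracks, and change of the base point along the walk.
\<close>
inductive loop_move ::
    "('a, 'b) pre_digraph \<Rightarrow> ('b \<Rightarrow> 'b) \<Rightarrow> 'a \<times> 'b awalk \<Rightarrow> 'a \<times> 'b awalk \<Rightarrow> bool"
  for G r where
  backtrack: "pre_digraph.awalk G u p v \<Longrightarrow> pre_digraph.awalk G v q u \<Longrightarrow>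
     a \<in> arcs G \<Longrightarrow> tail G a = v \<Longrightarrow> loop_move G r (u, p @ q) (u, p @ [a, r a] @ q)"
| rotate: "pre_digraph.awalk G u p v \<Longrightarrow> pre_digraph.awalk G v q u \<Longrightarrow>
     loop_move G r (u, p @ q) (v, q @ p)"

definition freely_homotopic ::
    "('a, 'b) pre_digraph \<Rightarrow> ('b \<Rightarrow> 'b) \<Rightarrow> 'a \<times> 'b awalk \<Rightarrow> 'a \<times> 'b awalk \<Rightarrow> bool" where
  "freely_homotopic G r = equivclp (loop_move G r)"

text \<open>
  \<open>(fv, fe)\<close> exhibits \<open>H\<close> as the graph obtained from \<open>G\<close> by identifying (oriented) edges:
  it is a surjective morphism of graphs, and it identifies two vertices only if this is forced
  by the identifications of edges. Heads need not be mentioned in the last condition,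
  since the arcs are closed under reversal.
\<close>
definition edge_identification ::
    "('a, 'b) pre_digraph \<Rightarrow> ('b \<Rightarrow> 'b) \<Rightarrow> ('c, 'd) pre_digraph \<Rightarrow> ('d \<Rightarrow> 'd) \<Rightarrow>
     ('a \<Rightarrow> 'c) \<Rightarrow> ('b \<Rightarrow> 'd) \<Rightarrow> bool" where
  "edge_identification G r H s fv fe \<longleftrightarrow>
     fv ` verts G = verts H \<and> fe ` arcs G = arcs H \<and>
     (\<forall>a\<in>arcs G. tail H (fe a) = fv (tail G a) \<and> head H (fe a) = fv (head G a) \<and>
        fe (r a) = s (fe a)) \<and>
     (\<forall>u\<in>verts G. \<forall>v\<in>verts G. fv u = fv v \<longrightarrow>
        equivclp (\<lambda>x y. \<exists>a\<in>arcs G. \<exists>b\<in>arcs G.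
          fe a = fe b \<and> x = tail G a \<and> y = tail G b) u v)"


section \<open>Tadpole graphs\<close>

text \<open>
  For \<open>l \<ge> 1\<close>: the vertices \<open>0, \<dots>, l - 1\<close> lie on the circuit, \<open>0\<close> is the junction, and
  \<open>0, l, l + 1, \<dots>, l + d - 1\<close> are the successive vertices of the attached path.
  Edge \<open>i\<close> leads from \<open>tadpole_from l i\<close> to \<open>tadpole_to l i\<close>;
  the Boolean component of an arc tells whether it has this direction.
\<close>
definition tadpole_from :: "nat \<Rightarrow> nat \<Rightarrow> nat" where
  "tadpole_from l i = (if i < l then i else if i = l then 0 else i - 1)"

definition tadpole_to :: "nat \<Rightarrow> nat \<Rightarrow> nat" where
  "tadpole_to l i = (if i < l then Suc i mod l else i)"

definition tadpole :: "nat \<Rightarrow> nat \<Rightarrow> (nat, nat \<times> bool) pre_digraph" where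
  "tadpole l d = \<lparr> verts = {..<l + d}, arcs = {..<l + d} \<times> UNIV,
     tail = (\<lambda>(i, b). if b then tadpole_from l i else tadpole_to l i),
     head = (\<lambda>(i, b). if b then tadpole_to l i else tadpole_from l i) \<rparr>"

definition tadpole_rev :: "nat \<Rightarrow> nat \<Rightarrow> nat \<times> bool \<Rightarrow> nat \<times> bool" where
  "tadpole_rev l d a = (if a \<in> arcs (tadpole l d) then (fst a, \<not> snd a) else a)"

definition tadpole_circuit :: "nat \<Rightarrow> (nat \<times> bool) awalk" where
  "tadpole_circuit l = map (\<lambda>i. (i, True)) [0..<l]"


section \<open>Trees and their automorphisms\<close>

text \<open>
  A tree has no loops or multiple edges, so its arcs are given as pairs of vertices,
  and an automorphism is determined by its action on the vertices.
\<close>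
definition is_tree :: "'a pair_pre_digraph \<Rightarrow> bool" where
  "is_tree X \<longleftrightarrow> serre_tree (with_proj X) (swap_in (parcs X))"

definition locally_finite :: "'a pair_pre_digraph \<Rightarrow> bool" where
  "locally_finite X \<longleftrightarrow> (\<forall>v\<in>pverts X. finite (out_arcs (with_proj X) v))"

definition aut_group :: "'a pair_pre_digraph \<Rightarrow> ('a \<Rightarrow> 'a) monoid" where
  "aut_group X = (BijGroup (pverts X))\<lparr> carrier :=
     {f \<in> Bij (pverts X). \<forall>u\<in>pverts X. \<forall>v\<in>pverts X.
        (f u, f v) \<in> parcs X \<longleftrightarrow> (u, v) \<in> parcs X} \<rparr>"

definition generated_group :: "'a pair_pre_digraph \<Rightarrow> ('a \<Rightarrow> 'a) set \<Rightarrow> ('a \<Rightarrow> 'a) monoid" where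
  "generated_group X A = (aut_group X)\<lparr> carrier := generate (aut_group X) A \<rparr>"

definition graph_dist :: "'a pair_pre_digraph \<Rightarrow> 'a \<Rightarrow> 'a \<Rightarrow> nat" where
  "graph_dist X u v = (LEAST n. \<exists>p. pre_digraph.awalk (with_proj X) u p v \<and> length p = n)"

definition set_dist :: "'a pair_pre_digraph \<Rightarrow> 'a set \<Rightarrow> 'a set \<Rightarrow> nat" where
  "set_dist X A B = (LEAST n. \<exists>u\<in>A. \<exists>v\<in>B. graph_dist X u v = n)"

definition fixed_verts :: "'a pair_pre_digraph \<Rightarrow> ('a \<Rightarrow> 'a) \<Rightarrow> 'a set" where
  "fixed_verts X f = {v \<in> pverts X. f v = v}"

definition elliptic :: "'a pair_pre_digraph \<Rightarrow> ('a \<Rightarrow> 'a) \<Rightarrow> bool" where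
  "elliptic X f \<longleftrightarrow> fixed_verts X f \<noteq> {}"

definition inverts_edge :: "'a pair_pre_digraph \<Rightarrow> ('a \<Rightarrow> 'a) \<Rightarrow> bool" where
  "inverts_edge X f \<longleftrightarrow> (\<exists>(u, v)\<in>parcs X. f u = v \<and> f v = u)"

definition hyperbolic :: "'a pair_pre_digraph \<Rightarrow> ('a \<Rightarrow> 'a) \<Rightarrow> bool" where
  "hyperbolic X f \<longleftrightarrow> \<not> elliptic X f \<and> \<not> inverts_edge X f"

definition translation_length :: "'a pair_pre_digraph \<Rightarrow> ('a \<Rightarrow> 'a) \<Rightarrow> nat" where
  "translation_length X f = (LEAST n. \<exists>v\<in>pverts X. graph_dist X v (f v) = n)"

definition axis :: "'a pair_pre_digraph \<Rightarrow> ('a \<Rightarrow> 'a) \<Rightarrow> 'a pair_pre_digraph" where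
  "axis X f = (let A = {v \<in> pverts X. graph_dist X v (f v) = translation_length X f}
     in \<lparr> pverts = A, parcs = parcs X \<inter> A \<times> A \<rparr>)"


section \<open>Groups acting on trees\<close>

definition without_inversions :: "'a pair_pre_digraph \<Rightarrow> ('a \<Rightarrow> 'a) monoid \<Rightarrow> bool" where
  "without_inversions X \<Gamma> \<longleftrightarrow> (\<forall>\<gamma>\<in>carrier \<Gamma>. \<not> inverts_edge X \<gamma>)"

definition pointwise_stabilizer :: "('a \<Rightarrow> 'a) monoid \<Rightarrow> 'a set \<Rightarrow> ('a \<Rightarrow> 'a) set" where
  "pointwise_stabilizer \<Gamma> S = {\<gamma> \<in> carrier \<Gamma>. \<forall>v\<in>S. \<gamma> v = v}"

definition discrete_group :: "'a pair_pre_digraph \<Rightarrow> ('a \<Rightarrow> 'a) monoid \<Rightarrow> bool" where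
  "discrete_group X \<Gamma> \<longleftrightarrow>
     (\<exists>S. is_tree S \<and> subgraph (with_proj S) (with_proj X) \<and> finite (pverts S) \<and>
        pointwise_stabilizer \<Gamma> (pverts S) = {\<one>\<^bsub>\<Gamma>\<^esub>})"

definition minimal_subtree ::
    "'a pair_pre_digraph \<Rightarrow> ('a \<Rightarrow> 'a) monoid \<Rightarrow> 'a pair_pre_digraph" where
  "minimal_subtree X \<Gamma> =
     (let H = {\<gamma> \<in> carrier \<Gamma>. hyperbolic X \<gamma>}
      in \<lparr> pverts = (\<Union>\<gamma>\<in>H. pverts (axis X \<gamma>)), parcs = (\<Union>\<gamma>\<in>H. parcs (axis X \<gamma>)) \<rparr>)"

definition faithful_on :: "('a \<Rightarrow> 'a) monoid \<Rightarrow> 'a pair_pre_digraph \<Rightarrow> bool" where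
  "faithful_on \<Gamma> T \<longleftrightarrow> pointwise_stabilizer \<Gamma> (pverts T) = {\<one>\<^bsub>\<Gamma>\<^esub>}"

text \<open>
  An arc of the quotient is an orbit of pairs; its tail and head are the orbits of the first
  and the second components, and its reverse is the converse relation.
  \<open>quotient_rev\<close> is the identity elsewhere, as \<^locale>\<open>bidirected_digraph\<close> demands.
\<close>
definition quotient_graph ::
    "'a pair_pre_digraph \<Rightarrow> ('a \<Rightarrow> 'a) monoid \<Rightarrow> ('a set, ('a \<times> 'a) set) pre_digraph" where
  "quotient_graph T \<Gamma> = \<lparr> verts = orbits \<Gamma> (pverts T) (\<lambda>\<gamma>. \<gamma>),
     arcs = orbits \<Gamma> (parcs T) (\<lambda>\<gamma>. map_prod \<gamma> \<gamma>),
     tail = (`) fst, head = (`) snd \<rparr>"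

definition quotient_rev ::
    "'a pair_pre_digraph \<Rightarrow> ('a \<Rightarrow> 'a) monoid \<Rightarrow> ('a \<times> 'a) set \<Rightarrow> ('a \<times> 'a) set" where
  "quotient_rev T \<Gamma> a = (if a \<in> arcs (quotient_graph T \<Gamma>) then a\<inverse> else a)"

definition cofinite_tree :: "'a pair_pre_digraph \<Rightarrow> bool" where
  "cofinite_tree X \<longleftrightarrow> finite (verts (quotient_graph X (aut_group X))) \<and>
     finite (arcs (quotient_graph X (aut_group X)))"

end

theory Submission
  imports Defs
begin

text \<open>
  Let \<open>u\<close> be a vertex fixed by \<open>g\<close> and \<open>w\<close> a vertex of the axis of \<open>h\<close>, as close to each other
  as possible. The geodesic \<open>p\<close> from \<open>w\<close> to \<open>h w\<close>, of length \<open>l\<close>, and the geodesic \<open>q\<close> from \<open>w\<close>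
  to \<open>u\<close>, of length \<open>d\<close>, form a lift of the tadpole graph: gluing \<open>w\<close> to \<open>h w\<close> closes \<open>p\<close> up to
  the circuit.

  The translates of \<open>p\<close> and \<open>q\<close> sweep out exactly the minimal subtree. On the one hand they form
  a connected invariant subgraph, because a generator moves \<open>p\<close> and \<open>q\<close> to translates that still
  meet them, and such a subgraph contains every axis (\<open>axis_in_invariant_subgraph\<close>). On the other
  hand \<open>p\<close> lies on the axis of \<open>h\<close>. If \<open>q\<close> is not empty, then by the choice of \<open>u\<close> and \<open>w\<close> the walk
  from \<open>u\<close> back along \<open>q\<close>, then along \<open>p\<close> and \<open>h q\<close> to \<open>h u\<close> is a geodesic that continues without backtracking under
  \<open>h g\<close>; so \<open>h g\<close> is hyperbolic and its axis contains \<open>q\<close> (\<open>bridge_translates\<close>). Both arguments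
  rest on one criterion: an automorphism \<open>f\<close> is hyperbolic with \<open>x\<close> on its axis if and only if the
  geodesic \<open>s\<close> from \<open>x\<close> to \<open>f x\<close> is nonempty and \<open>s\<close> followed by \<open>f s\<close> is reduced
  (\<open>translates_hyperbolic\<close>, \<open>hyperbolic_translates\<close>).

  It follows that the quotient \<open>Y\<close> is the image of the tadpole under a morphism of graphs. The rest
  uses that closed walks in a tree cancel to the empty walk (\<open>closed_walk_cancels\<close>), applied to
  two kinds of data that walks in the swept tree carry and that cancellation respects.

  \<^item> Every arc of the swept tree has labels, namely the arcs of the tadpole with the same image in
    \<open>Y\<close>, and one can ask that the labels of successive arcs fit together up to the identifications of
    tadpole vertices that are forced by identified arcs. If two vertices of the tadpole have the same
    image in \<open>Y\<close>, then a closed walk that is coherent in this sense leads from the one to the other;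
    cancelling it shows that their identification is forced (\<open>identified_if_same_orbit\<close>).

  \<^item> Every walk from \<open>w\<close> to \<open>\<gamma> w\<close> projects to a closed walk in \<open>Y\<close>, whose homotopy class depends
    only on \<open>\<gamma>\<close> and is multiplicative in \<open>\<gamma>\<close>. For \<open>g\<close> it is trivial, since \<open>q\<close> followed by the
    reverse of \<open>g q\<close> projects to a walk and its reverse; for \<open>h\<close> it is the class of the image \<open>\<beta>\<close> of
    the circuit of the tadpole. All closed walks in \<open>Y\<close> lift, so the fundamental group of \<open>Y\<close> is
    generated by \<open>\<beta>\<close> (\<open>cyclic_quotient\<close>).

  A finite connected graph whose fundamental group is generated by \<open>\<beta>\<close> has all the stated properties.
  Counting how often a walk traverses an edge, with sign, is invariant under homotopy, and for all
  closed walks these counts are integer multiples of those of \<open>\<beta>\<close>. Two edges outside a spanning tree,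
  or two circuits, would give independent counts; and a circuit traverses each of its edges once,
  so it is homotopic to \<open>\<beta>\<close> or to its reverse.
\<close>

section \<open>Walks and cancellation of backtracks\<close>

inductive cancel :: "('b \<Rightarrow> 'b) \<Rightarrow> 'b list \<Rightarrow> 'b list \<Rightarrow> bool" for r where
  "cancel r (xs @ [a, r a] @ ys) (xs @ ys)"

text \<open>
  The reversal is constrained on the arcs only. This way \<^const>\<open>prod.swap\<close> can serve as the reversal
  of a symmetric graph without loops whose arcs are pairs.
\<close>
locale serre_graph = wf_digraph G for G :: "('a, 'b) pre_digraph" +
  fixes rv :: "'b \<Rightarrow> 'b"
  assumes rv_in_arcs: "a \<in> arcs G \<Longrightarrow> rv a \<in> arcs G"
    and rv_rv: "a \<in> arcs G \<Longrightarrow> rv (rv a) = a"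
    and rv_neq: "a \<in> arcs G \<Longrightarrow> rv a \<noteq> a"
    and tail_rv: "a \<in> arcs G \<Longrightarrow> tail G (rv a) = head G a"

lemma (in bidirected_digraph) serre_graph: "serre_graph G arev"
  by unfold_locales (auto simp: arev_neq)

context serre_graph
begin

lemma head_rv: "a \<in> arcs G \<Longrightarrow> head G (rv a) = tail G a"
  using tail_rv[OF rv_in_arcs] rv_rv by simp

lemmas rv_simps [simp] = rv_in_arcs rv_rv rv_neq rv_neq[symmetric] tail_rv head_rv

lemma rv_inject [simp]: "a \<in> arcs G \<Longrightarrow> b \<in> arcs G \<Longrightarrow> rv a = rv b \<longleftrightarrow> a = b"
  by (metis rv_rv)

lemma rv_eq_iff: "a \<in> arcs G \<Longrightarrow> b \<in> arcs G \<Longrightarrow> rv a = b \<longleftrightarrow> a = rv b"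
  by auto

lemma awalk_append_split:
  "awalk u (p @ q) v \<longleftrightarrow> (\<exists>w. awalk u p w \<and> awalk w q v)"
  by (metis awalk_append_iff awalk_appendI awlast_of_awalk NOMATCH_def)

lemma awalk_arcs: "awalk u p v \<Longrightarrow> set p \<subseteq> arcs G"
  by auto

definition rwalk :: "'b list \<Rightarrow> 'b list" where
  "rwalk p = rev (map rv p)"

lemma rwalk_simps [simp]:
  "rwalk [] = []" "rwalk (a # p) = rwalk p @ [rv a]" "rwalk (p @ q) = rwalk q @ rwalk p"
  "length (rwalk p) = length p" "rwalk p = [] \<longleftrightarrow> p = []"
  by (auto simp: rwalk_def)

lemma rwalk_rwalk: "set p \<subseteq> arcs G \<Longrightarrow> rwalk (rwalk p) = p"
  by (induction p) auto

lemma set_rwalk: "set (rwalk p) = rv ` set p"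
  by (auto simp: rwalk_def)

lemma set_rwalk_arcs: "set p \<subseteq> arcs G \<Longrightarrow> set (rwalk p) \<subseteq> arcs G"
  by (auto simp: set_rwalk)

lemma awalk_rwalk: "awalk u p v \<Longrightarrow> awalk v (rwalk p) u"
proof (induction p arbitrary: u)
  case (Cons a p)
  then show ?case
    by (auto simp: awalk_Cons_iff awalk_append_split awalk_Nil_iff simp del: awalk_append_iff)
qed (auto simp: awalk_Nil_iff)

lemma connected_awalk:
  assumes "connected G" "u \<in> verts G" "v \<in> verts G"
  shows "\<exists>p. awalk u p v"
proof -
  have "symmetric G"
    unfolding symmetric_def
  proof (intro symI)
    fix x y assume "(x, y) \<in> arcs_ends G"
    then obtain a where "a \<in> arcs G" "x = tail G a" "y = head G a"
      by (auto simp: arcs_ends_conv)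
    then show "(y, x) \<in> arcs_ends G"
      by (metis in_arcs_imp_in_arcs_ends rv_in_arcs tail_rv head_rv)
  qed
  then have "strongly_connected G"
    using assms(1) by (rule symmetric_connected_imp_strongly_connected)
  then show ?thesis
    using assms(2,3) by (auto simp: strongly_connected_def reachable_awalk)
qed

lemma cancel_awalk: "cancel rv p q \<Longrightarrow> awalk u p v \<Longrightarrow> awalk u q v"
  by (cases rule: cancel.cases, assumption) (auto simp: awalk_append_split awalk_Cons_iff)

lemma cancels_awalk: "(cancel rv)\<^sup>*\<^sup>* p q \<Longrightarrow> awalk u p v \<Longrightarrow> awalk u q v"
  by (induction rule: rtranclp_induct) (auto intro: cancel_awalk)

definition reduced :: "'b list \<Rightarrow> bool" where
  "reduced p \<longleftrightarrow> successively (\<lambda>a b. b \<noteq> rv a) p"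

lemma reduced_Nil [simp]: "reduced []" and reduced_single [simp]: "reduced [a]"
  by (auto simp: reduced_def)

lemma reduced_append_iff:
  "reduced (p @ q) \<longleftrightarrow>
     reduced p \<and> reduced q \<and> (p = [] \<or> q = [] \<or> hd q \<noteq> rv (last p))"
  by (auto simp: reduced_def successively_append_iff)

lemma reduced_Cons_iff:
  "reduced (a # p) \<longleftrightarrow> reduced p \<and> (p = [] \<or> hd p \<noteq> rv a)"
  by (auto simp: reduced_def successively_Cons)

lemma reduced_rwalk:
  assumes "set p \<subseteq> arcs G" "reduced p"
  shows "reduced (rwalk p)"
  using assms
proof (induction p)
  case (Cons a p)
  then show ?case
    by (cases p) (auto simp: reduced_Cons_iff reduced_append_iff)
qed auto

lemma not_reduced_cancel: "\<not> reduced p \<Longrightarrow> \<exists>q. cancel rv p q"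
proof (induction p)
  case (Cons a p)
  show ?case
  proof (cases "reduced p")
    case True
    with Cons.prems have "p = rv a # tl p"
      by (cases p) (auto simp: reduced_Cons_iff)
    then have "cancel rv (a # p) ([] @ tl p)"
      using cancel.intros[of rv "[]" a "tl p"] by simp
    then show ?thesis ..
  next
    case False
    then obtain q where "cancel rv p q" using Cons.IH by blast
    then have "cancel rv (a # p) (a # q)"
      by cases (metis append_Cons cancel.intros)
    then show ?thesis ..
  qed
qed simp

lemma cancel_shorter: "cancel r p q \<Longrightarrow> length q < length p"
  by (cases rule: cancel.cases, assumption) auto

lemma cancel_subset: "cancel r p q \<Longrightarrow> set q \<subseteq> set p"
  by (cases rule: cancel.cases, assumption) auto

lemma cancels_shorter: "(cancel r)\<^sup>*\<^sup>* p q \<Longrightarrow> length q \<le> length p"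
  by (induction rule: rtranclp_induct) (auto dest: cancel_shorter)

lemma cancels_subset: "(cancel r)\<^sup>*\<^sup>* p q \<Longrightarrow> set q \<subseteq> set p"
  by (induction rule: rtranclp_induct) (auto dest!: cancel_subset)

lemma exists_reduced_form: "\<exists>q. (cancel rv)\<^sup>*\<^sup>* p q \<and> reduced q"
proof (induction "length p" arbitrary: p rule: less_induct)
  case less
  show ?case
  proof (cases "reduced p")
    case False
    then obtain q where "cancel rv p q" using not_reduced_cancel by blast
    with less[of q] show ?thesis
      by (meson cancel_shorter converse_rtranclp_into_rtranclp)
  qed auto
qed

end

section \<open>Connected graphs without circuits\<close>

locale circuit_free = serre_graph +
  assumes connected: "connected G"
    and no_circuit: "\<not> circuit G rv p"
begin

text \<open>
  A nonempty reduced closed walk that repeats a vertex contains a shorter one; one that does not is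
  a circuit, as a reduced walk is not a backtrack.
\<close>
lemma reduced_closed_walk_Nil: "awalk u p u \<Longrightarrow> reduced p \<Longrightarrow> p = []"
proof (induction "length p" arbitrary: u p rule: less_induct)
  case less
  show ?case
  proof (rule ccontr)
    assume "p \<noteq> []"
    show False
    proof (cases "distinct (tl (awalk_verts u p))")
      case True
      with less.prems \<open>p \<noteq> []\<close> have "cycle p"
        by (auto simp: cycle_def)
      moreover have "p \<noteq> [a, rv a]" for a
        using less.prems(2) by (auto simp: reduced_Cons_iff)
      ultimately show False
        using no_circuit[of p] by (auto simp: circuit_def)
    next
      case False
      obtain e es where p: "p = e # es" using \<open>p \<noteq> []\<close> by (cases p) auto
      then have "awalk (head G e) es u" "\<not> distinct (awalk_verts (head G e) es)"
        using False less.prems(1) by (auto simp: awalk_Cons_iff)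
      then obtain q r s w where "es = q @ r @ s" "0 < length r" "awalk w r w"
        by (blast dest: awalk_not_distinct_decomp)
      moreover have "reduced r"
        using less.prems(2) p calculation by (auto simp: reduced_append_iff reduced_Cons_iff)
      ultimately show False
        using less.hyps[of r w] p by auto
    qed
  qed
qed

text \<open>
  This is the form in which the absence of circuits is used below: whatever data on walks are
  respected by cancellation are trivial on closed walks.
\<close>
lemma closed_walk_cancels: "awalk u p u \<Longrightarrow> (cancel rv)\<^sup>*\<^sup>* p []"
  using exists_reduced_form[of p] reduced_closed_walk_Nil cancels_awalk by metis

text \<open>
  If two reduced walks with the same ends differ in their last arcs, then the first followed by the
  reverse of the second is reduced and closed; common last arcs can be stripped.
\<close>
lemma reduced_walk_unique:
  "awalk u p v \<Longrightarrow> awalk u q v \<Longrightarrow> reduced p \<Longrightarrow> reduced q \<Longrightarrow> p = q"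
proof (induction p arbitrary: q v rule: rev_induct)
  case Nil
  then show ?case
    by (auto simp: awalk_Nil_iff dest: reduced_closed_walk_Nil)
next
  case (snoc a p)
  show ?case
  proof (cases q rule: rev_cases)
    case Nil
    with snoc.prems have "awalk u (p @ [a]) u" by (auto simp: awalk_Nil_iff)
    with snoc.prems show ?thesis by (blast dest: reduced_closed_walk_Nil)
  next
    case (snoc q' b)
    have a: "awalk u p (tail G a)" "head G a = v" "a \<in> arcs G" "reduced p"
      and b: "awalk u q' (tail G b)" "head G b = v" "b \<in> arcs G" "reduced q'"
      using snoc.prems snoc
      by (auto simp: awalk_append_split awalk_Cons_iff awalk_Nil_iff reduced_append_iff)
    show ?thesis
    proof (cases "a = b")
      case True
      then show ?thesis using snoc.IH[of "tail G a" q'] a b snoc by auto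
    next
      case False
      have "awalk u ((p @ [a]) @ rwalk q) u"
        using awalk_appendI[OF snoc.prems(1) awalk_rwalk[OF snoc.prems(2)]] .
      moreover have "reduced ((p @ [a]) @ rwalk q)"
        using snoc.prems snoc False a b reduced_rwalk[of q] awalk_arcs[OF snoc.prems(2)]
        by (subst reduced_append_iff) (auto simp: rv_eq_iff)
      ultimately show ?thesis
        using reduced_closed_walk_Nil by blast
    qed
  qed
qed

lemma reduced_walk_exists:
  assumes "u \<in> verts G" "v \<in> verts G"
  shows "\<exists>p. awalk u p v \<and> reduced p"
  using connected_awalk[OF connected assms] exists_reduced_form cancels_awalk by blast

lemma reduced_walk_shortest:
  assumes "awalk u p v" "reduced p" "awalk u q v"
  shows "length p \<le> length q" "set p \<subseteq> set q"
  using exists_reduced_form[of q] cancels_awalk[OF _ assms(3)] assms reduced_walk_unique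
    cancels_shorter cancels_subset by metis+

text \<open>
  The continuation \<open>q\<close> can cancel at most \<open>length q\<close> arcs of \<open>p\<close>, counted from the end, so the first
  arc of \<open>p\<close> survives. In other words, points close to the end of a long geodesic are seen from its
  start in the direction of its end.
\<close>
lemma first_arc_persists:
  assumes "awalk x p z" "reduced p" "awalk z q y" "length q < length p"
  shows "\<exists>p'. awalk x p' y \<and> reduced p' \<and> p' \<noteq> [] \<and> hd p' = hd p"
  using assms
proof (induction q arbitrary: p z)
  case Nil
  then show ?case by (auto simp: awalk_Nil_iff)
next
  case (Cons b q)
  obtain p' a where p: "p = p' @ [a]" using Cons.prems by (cases p rule: rev_cases) auto
  have b: "b \<in> arcs G" "tail G b = z" "awalk (head G b) q y"
    using Cons.prems by (auto simp: awalk_Cons_iff)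
  have a: "a \<in> arcs G" "head G a = z" "awalk x p' (tail G a)"
    using Cons.prems p by (auto simp: awalk_Cons_iff awalk_append_split awalk_Nil_iff)
  show ?case
  proof (cases "b = rv a")
    case True
    then have "\<exists>p''. awalk x p'' y \<and> reduced p'' \<and> p'' \<noteq> [] \<and> hd p'' = hd p'"
      using Cons.IH[of p' "head G b"] Cons.prems a b p by (auto simp: reduced_append_iff)
    moreover have "p' \<noteq> []" using Cons.prems p by auto
    ultimately show ?thesis using p by auto
  next
    case False
    have "awalk x (p @ [b]) (head G b)"
      using Cons.prems(1) b by (metis arc_implies_awalk awalk_appendI)
    moreover have "reduced (p @ [b])"
      using Cons.prems(2) False p by (subst reduced_append_iff) auto
    ultimately have "\<exists>p''. awalk x p'' y \<and> reduced p'' \<and> p'' \<noteq> [] \<and> hd p'' = hd (p @ [b])"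
      using Cons.IH[of "p @ [b]" "head G b"] b Cons.prems by auto
    then show ?thesis using p by (cases p') auto
  qed
qed

end

section \<open>Homotopy of walks\<close>

context serre_graph
begin

text \<open>
  Homotopy relative to the end points. A step only mentions that the longer list is a walk, since
  the shorter one then is a walk as well.
\<close>
definition homotopic :: "'a \<Rightarrow> 'a \<Rightarrow> 'b list \<Rightarrow> 'b list \<Rightarrow> bool" where
  "homotopic u v = equivclp (\<lambda>p q. awalk u p v \<and> cancel rv p q)"

lemma homotopic_refl [simp]: "homotopic u v p p"
  and homotopic_sym: "homotopic u v p q \<Longrightarrow> homotopic u v q p"
  and homotopic_trans [trans]: "homotopic u v p q \<Longrightarrow> homotopic u v q s \<Longrightarrow> homotopic u v p s"
  unfolding homotopic_def by (auto intro: equivclp_sym equivclp_trans)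

lemma homotopic_awalk: "homotopic u v p q \<Longrightarrow> awalk u p v \<Longrightarrow> awalk u q v"
  unfolding homotopic_def
  by (induction rule: equivclp_induct) (auto intro: cancel_awalk)

lemma cancels_homotopic: "(cancel rv)\<^sup>*\<^sup>* p q \<Longrightarrow> awalk u p v \<Longrightarrow> homotopic u v p q"
proof (induction rule: rtranclp_induct)
  case (step q s)
  then have "homotopic u v q s"
    unfolding homotopic_def by (intro r_into_equivclp) (auto intro: cancels_awalk)
  with step show ?case using homotopic_trans by blast
qed simp

text \<open>
  Invariants of homotopy are constructed by looking at a single cancellation.
\<close>
lemma homotopic_map:
  assumes "homotopic u v p q"
    and "\<And>x y. awalk u x v \<Longrightarrow> cancel rv x y \<Longrightarrow> R (F x) (F y)"
  shows "equivclp R (F p) (F q)"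
  using assms(1) unfolding homotopic_def
proof (induction rule: equivclp_induct)
  case (step y z)
  then show ?case
    using assms(2)[of y z] assms(2)[of z y] by (meson equivclp_into_equivclp)
qed simp

lemma cancel_append: "cancel r p q \<Longrightarrow> cancel r (x @ p @ y) (x @ q @ y)"
proof (cases rule: cancel.cases, assumption)
  fix xs a ys assume "p = xs @ [a, r a] @ ys" "q = xs @ ys"
  then show ?thesis using cancel.intros[of r "x @ xs" a "ys @ y"] by simp
qed

lemma homotopic_append:
  assumes "homotopic u v p q" "awalk u' x u" "awalk v y v'"
  shows "homotopic u' v' (x @ p @ y) (x @ q @ y)"
  unfolding homotopic_def[of u' v']
  using assms(1)
proof (rule homotopic_map)
  fix p q assume "awalk u p v" "cancel rv p q"
  with assms(2,3) show "awalk u' (x @ p @ y) v' \<and> cancel rv (x @ p @ y) (x @ q @ y)"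
    by (intro conjI awalk_appendI cancel_append) auto
qed

lemma rwalk_cancels: "set p \<subseteq> arcs G \<Longrightarrow> (cancel rv)\<^sup>*\<^sup>* (p @ rwalk p) []"
proof (induction p rule: rev_induct)
  case (snoc a p)
  have "cancel rv ((p @ [a]) @ rwalk (p @ [a])) (p @ rwalk p)"
    using cancel.intros[of rv p a "rwalk p"] by simp
  with snoc show ?case
    by (auto intro: converse_rtranclp_into_rtranclp)
qed simp

lemma homotopic_rwalk:
  "awalk u p v \<Longrightarrow> homotopic u u (p @ rwalk p) []"
  by (intro cancels_homotopic rwalk_cancels) (auto intro: awalk_appendI awalk_rwalk simp del: awalk_append_iff)

lemma homotopicI_closed:
  assumes "awalk u p v" "awalk u q v" "homotopic u u (p @ rwalk q) []"
  shows "homotopic u v p q"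
proof -
  have "homotopic v v (rwalk q @ q) []"
    using homotopic_rwalk[OF awalk_rwalk[OF assms(2)]] rwalk_rwalk awalk_arcs[OF assms(2)] by simp
  moreover have "awalk v [] v" using assms by (auto simp: awalk_Nil_iff)
  ultimately have "homotopic u v (p @ (rwalk q @ q) @ []) (p @ [] @ [])"
    using assms(1) by (intro homotopic_append)
  moreover have "homotopic u v ([] @ (p @ rwalk q) @ q) ([] @ [] @ q)"
    using assms by (intro homotopic_append) (auto simp: awalk_Nil_iff)
  ultimately have "homotopic u v (p @ rwalk q @ q) p" "homotopic u v (p @ rwalk q @ q) q"
    by simp_all
  then show ?thesis
    by (rule homotopic_trans[OF homotopic_sym])
qed

lemma homotopic_rwalks:
  assumes "homotopic u v p q" "awalk u p v"
  shows "homotopic v u (rwalk p) (rwalk q)"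
proof (rule homotopicI_closed)
  have q: "awalk u q v" using homotopic_awalk[OF assms] .
  show p': "awalk v (rwalk p) u" and "awalk v (rwalk q) u"
    using assms(2) q by (auto intro: awalk_rwalk)
  have u: "awalk u [] u" and v: "awalk v [] v" using assms(2) by (auto simp: awalk_Nil_iff)
  have "homotopic v v (rwalk p @ q @ []) (rwalk p @ p @ [])"
    using homotopic_append[OF homotopic_sym[OF assms(1)] p' v] .
  also have "homotopic v v \<dots> []"
    using homotopic_rwalk[OF p'] rwalk_rwalk[OF awalk_arcs[OF assms(2)]] by simp
  finally show "homotopic v v (rwalk p @ rwalk (rwalk q)) []"
    using rwalk_rwalk[OF awalk_arcs[OF q]] by simp
qed

definition loop_power :: "'b list \<Rightarrow> int \<Rightarrow> 'b list" where
  "loop_power p k =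
     (if k \<ge> 0 then concat (replicate (nat k) p) else concat (replicate (nat (- k)) (rwalk p)))"

lemma loop_power_simps [simp]: "loop_power p 0 = []" "loop_power p 1 = p"
  by (auto simp: loop_power_def)

lemma concat_replicate_append: "concat (replicate n p) @ p = p @ concat (replicate n p)"
  by (induction n) auto

lemma rwalk_concat_replicate: "rwalk (concat (replicate n p)) = concat (replicate n (rwalk p))"
  by (induction n) (auto simp: concat_replicate_append)

lemma rwalk_loop_power:
  "set p \<subseteq> arcs G \<Longrightarrow> rwalk (loop_power p k) = loop_power p (- k)"
  by (auto simp: loop_power_def rwalk_concat_replicate rwalk_rwalk)

lemma loop_power_Suc: "k \<ge> 0 \<Longrightarrow> loop_power p (k + 1) = p @ loop_power p k"
  by (simp add: loop_power_def nat_add_distrib)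

lemma loop_power_pred: "k \<le> 0 \<Longrightarrow> loop_power p (k - 1) = rwalk p @ loop_power p k"
proof (cases "k = 0")
  assume "k \<le> 0" "k \<noteq> 0"
  then have "nat (- (k - 1)) = Suc (nat (- k))" by simp
  with \<open>k \<le> 0\<close> \<open>k \<noteq> 0\<close> show ?thesis by (simp add: loop_power_def)
qed (simp add: loop_power_def)

lemma awalk_loop_power: "awalk u p u \<Longrightarrow> awalk u (loop_power p k) u"
proof (induction k rule: int_induct[where k = 0])
  case base
  then show ?case by (auto simp: awalk_Nil_iff)
next
  case (step1 i)
  then show ?case by (auto simp: loop_power_Suc intro: awalk_appendI simp del: awalk_append_iff)
next
  case (step2 i)
  then show ?case
    by (auto simp: loop_power_pred intro: awalk_appendI awalk_rwalk simp del: awalk_append_iff)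
qed

text \<open>
  If the absolute value of the exponent decreases, then the new factor cancels against a copy of its
  reverse; otherwise the two lists are equal.
\<close>
lemma loop_power_shift:
  assumes "awalk u p u"
  shows "homotopic u u (p @ loop_power p k) (loop_power p (k + 1))"
    and "homotopic u u (rwalk p @ loop_power p k) (loop_power p (k - 1))"
proof -
  have u: "awalk u [] u" using assms by (auto simp: awalk_Nil_iff)
  have rr: "rwalk (rwalk p) = p" using assms by (intro rwalk_rwalk) auto
  note 1 = homotopic_append[OF homotopic_rwalk[OF assms] u awalk_loop_power[OF assms]]
  note 2 = homotopic_append[OF homotopic_rwalk[OF awalk_rwalk[OF assms]] u awalk_loop_power[OF assms]]
  show "homotopic u u (p @ loop_power p k) (loop_power p (k + 1))"
    using loop_power_Suc[of k p] loop_power_pred[of "k + 1" p] 1[of "k + 1"] by (cases "k \<ge> 0") auto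
  show "homotopic u u (rwalk p @ loop_power p k) (loop_power p (k - 1))"
    using loop_power_pred[of k p] loop_power_Suc[of "k - 1" p] 2[of "k - 1"] rr by (cases "k \<le> 0") auto
qed

text \<open>
  Exponents of both signs occur, so the equation holds only up to homotopy.
\<close>
lemma loop_power_add:
  assumes p: "awalk u p u"
  shows "homotopic u u (loop_power p j @ loop_power p k) (loop_power p (j + k))"
proof (induction j rule: int_induct[where k = 0])
  case base
  then show ?case by simp
next
  case (step1 i)
  have "homotopic u u (p @ (loop_power p i @ loop_power p k) @ []) (p @ loop_power p (i + k) @ [])"
    using step1 p by (intro homotopic_append) (auto simp: awalk_Nil_iff)
  with step1 have "homotopic u u (loop_power p (i + 1) @ loop_power p k) (p @ loop_power p (i + k))"
    by (simp add: loop_power_Suc)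
  also have "homotopic u u \<dots> (loop_power p (i + k + 1))"
    using loop_power_shift(1)[OF p] .
  finally show ?case by (simp add: algebra_simps)
next
  case (step2 i)
  have "homotopic u u (rwalk p @ (loop_power p i @ loop_power p k) @ [])
          (rwalk p @ loop_power p (i + k) @ [])"
    using step2 p awalk_rwalk by (intro homotopic_append) (auto simp: awalk_Nil_iff)
  with step2 have "homotopic u u (loop_power p (i - 1) @ loop_power p k) (rwalk p @ loop_power p (i + k))"
    by (simp add: loop_power_pred)
  also have "homotopic u u \<dots> (loop_power p (i + k - 1))"
    using loop_power_shift(2)[OF p] .
  finally show ?case by (simp add: algebra_simps)
qed

lemma homotopic_freely_homotopic:
  assumes "homotopic u u p q"
  shows "freely_homotopic G rv (u, p) (u, q)"
proof -
  have "equivclp (\<lambda>x y. loop_move G rv y x) (u, p) (u, q)"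
    using assms
  proof (rule homotopic_map[where F = "Pair u"])
    fix x y assume "awalk u x u" "cancel rv x y"
    from this(2,1) show "loop_move G rv (u, y) (u, x)"
    proof cases
      case (1 xs a ys)
      then show ?thesis
        using \<open>awalk u x u\<close> loop_move.backtrack[of G u xs "tail G a" ys a rv]
        by (auto simp: awalk_append_split awalk_Cons_iff simp del: awalk_append_iff)
    qed
  qed
  moreover have "(\<lambda>x y. loop_move G rv y x) = (loop_move G rv)\<inverse>\<inverse>"
    by (auto simp: fun_eq_iff)
  ultimately show ?thesis
    by (simp add: freely_homotopic_def del: conversep_iff)
qed

lemma freely_homotopic_conjugate:
  assumes "awalk u p u" "awalk v s u"
  shows "freely_homotopic G rv (u, p) (v, s @ p @ rwalk s)"
proof -
  have "loop_move G rv (v, s @ (p @ rwalk s)) (u, (p @ rwalk s) @ s)"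
    using assms awalk_rwalk by (intro loop_move.rotate) auto
  moreover have "homotopic u u (p @ (rwalk s @ s) @ []) (p @ [] @ [])"
    using homotopic_rwalk[OF awalk_rwalk[OF assms(2)]] rwalk_rwalk[of s] assms
    by (intro homotopic_append[of u u _ _ u]) (auto simp: awalk_Nil_iff)
  then have "freely_homotopic G rv (u, (p @ rwalk s) @ s) (u, p)"
    by (intro homotopic_freely_homotopic) simp
  ultimately show ?thesis
    unfolding freely_homotopic_def
    by (blast intro: equivclp_sym equivclp_trans[OF r_into_equivclp])
qed

section \<open>Signed numbers of traversals\<close>

definition crossing :: "'b \<Rightarrow> 'b list \<Rightarrow> int" where
  "crossing e p = int (count_list p e) - int (count_list p (rv e))"

lemma crossing_simps [simp]:
  "crossing e [] = 0" "crossing e (p @ q) = crossing e p + crossing e q"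
  by (auto simp: crossing_def)

lemma crossing_rwalk:
  assumes "set p \<subseteq> arcs G" "e \<in> arcs G"
  shows "crossing e (rwalk p) = - crossing e p"
proof -
  have "count_list (rwalk p) f = count_list p (rv f)" if "f \<in> arcs G" for f
    using assms(1) that by (induction p) (auto simp: rv_eq_iff)
  then show ?thesis using assms(2) by (simp add: crossing_def)
qed

text \<open>
  A backtrack traverses its edge once in each direction. Hence the count is a homomorphism from the
  fundamental group to the integers; these homomorphisms are the only homology needed below.
\<close>
lemma crossing_homotopic:
  assumes "homotopic u v p q" "e \<in> arcs G"
  shows "crossing e p = crossing e q"
proof -
  have "equivclp (=) (crossing e p) (crossing e q)"
    using assms(1)
  proof (rule homotopic_map)
    fix x y assume "awalk u x v" "cancel rv x y"
    from this(2,1) show "crossing e x = crossing e y"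
    proof cases
      case (1 xs a ys)
      then have "a \<in> arcs G" using \<open>awalk u x v\<close> by (auto simp: awalk_Cons_iff)
      then show ?thesis using 1 \<open>e \<in> arcs G\<close> by (auto simp: crossing_def)
    qed
  qed
  then show ?thesis by (induction rule: equivclp_induct) auto
qed

lemma crossing_loop_power:
  assumes "set p \<subseteq> arcs G" "e \<in> arcs G"
  shows "crossing e (loop_power p k) = k * crossing e p"
proof (induction k rule: int_induct[where k = 0])
  case (step1 i)
  then show ?case by (simp add: loop_power_Suc ring_distribs)
next
  case (step2 i)
  then show ?case using crossing_rwalk[OF assms] by (simp add: loop_power_pred ring_distribs)
qed simp

text \<open>
  The heads of the arcs of a circuit are distinct, so each arc is determined by its head. If \<open>rv a\<close>
  occurs after \<open>a\<close>, then its predecessor has the same head as \<open>a\<close> and hence is \<open>a\<close> itself; and the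
  cyclic predecessor of \<open>a\<close> has the same head as \<open>rv a\<close> and hence is \<open>rv a\<close>. So the circuit
  would be the backtrack \<open>[a, rv a]\<close>.
\<close>
lemma circuit_not_reverse_arcs:
  assumes "circuit G rv p" "e \<in> set p"
  shows "rv e \<notin> set p"
proof
  assume re: "rv e \<in> set p"
  obtain u where p: "awalk u p u" "distinct (tl (awalk_verts u p))" "p \<noteq> []"
    using assms(1) by (auto simp: circuit_def cycle_def)
  have heads: "distinct (map (head G) p)"
    using p awalk_verts_conv'[of u p u] by auto
  have key: False if "p = xs @ a # ys @ rv a # zs" for xs a ys zs
  proof -
    have a: "a \<in> arcs G" using p that by auto
    \<comment> \<open>The predecessor of \<open>rv a\<close> would end in the head of \<open>a\<close>.\<close>
    have ys: "ys = []"
    proof (rule ccontr)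
      assume "ys \<noteq> []"
      then obtain ys' f where "ys = ys' @ [f]" by (cases ys rule: rev_cases) auto
      with p(1) that heads a show False
        by (auto simp: awalk_append_split awalk_Cons_iff awalk_Nil_iff simp del: awalk_append_iff)
    qed
    \<comment> \<open>The predecessor of \<open>a\<close> would end in the head of \<open>rv a\<close>.\<close>
    have xs: "xs = []"
    proof (rule ccontr)
      assume "xs \<noteq> []"
      then obtain xs' f where "xs = xs' @ [f]" by (cases xs rule: rev_cases) auto
      with p(1) that heads a show False
        by (auto simp: awalk_append_split awalk_Cons_iff awalk_Nil_iff simp del: awalk_append_iff)
    qed
    \<comment> \<open>As the walk is closed, its last arc precedes \<open>a\<close> in cyclic order.\<close>
    have zs: "zs = []"
    proof (rule ccontr)
      assume "zs \<noteq> []"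
      then obtain zs' f where "zs = zs' @ [f]" by (cases zs rule: rev_cases) auto
      with p(1) that heads a xs show False
        by (auto simp: awalk_append_split awalk_Cons_iff awalk_Nil_iff simp del: awalk_append_iff)
    qed
    show False
      using assms(1) that xs ys zs by (auto simp: circuit_def)
  qed
  have e: "e \<in> arcs G" using assms(2) p by auto
  obtain xs zs where xz: "p = xs @ e # zs" using assms(2) by (meson split_list)
  with re e have "rv e \<in> set xs \<or> rv e \<in> set zs" by auto
  then show False
  proof
    assume "rv e \<in> set xs"
    then obtain x1 x2 where "xs = x1 @ rv e # x2" by (meson split_list)
    with xz e key[of x1 "rv e" x2 zs] show False by auto
  next
    assume "rv e \<in> set zs"
    then obtain x1 x2 where "zs = x1 @ rv e # x2" by (meson split_list)
    with xz e key[of xs e x1 x2] show False by auto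
  qed
qed

lemma crossing_not_in: "e \<notin> set p \<Longrightarrow> rv e \<notin> set p \<Longrightarrow> crossing e p = 0"
  by (simp add: crossing_def count_notin)

lemma crossing_circuit:
  assumes "circuit G rv p" "e \<in> set p"
  shows "crossing e p = 1"
proof -
  have "distinct p" using assms(1) by (auto simp: circuit_def cycle_conv)
  then have "count_list p e = 1" using assms(2) by (auto dest!: split_list simp: count_notin)
  moreover have "count_list p (rv e) = 0"
    using circuit_not_reverse_arcs[OF assms] by simp
  ultimately show ?thesis by (simp add: crossing_def)
qed

lemma card_sccs_verts_connected:
  assumes "connected G"
  shows "card sccs_verts = 1"
proof -
  have ne: "verts G \<noteq> {}" using assms by (auto simp: connected_conv)
  have r: "u \<rightarrow>\<^sup>*\<^bsub>G\<^esub> v" if "u \<in> verts G" "v \<in> verts G" for u v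
    using connected_awalk[OF assms that] by (auto simp: reachable_awalk)
  have "sccs_verts = {verts G}"
  proof (intro equalityI subsetI)
    fix S assume S: "S \<in> sccs_verts"
    have SV: "S \<subseteq> verts G"
    proof
      fix x assume "x \<in> S"
      with S have "x \<rightarrow>\<^sup>*\<^bsub>G\<^esub> x" unfolding sccs_verts_def by auto
      then show "x \<in> verts G" by (rule reachable_in_verts)
    qed
    moreover have "verts G \<subseteq> S" using S r SV unfolding sccs_verts_def by blast
    ultimately show "S \<in> {verts G}" by auto
  next
    fix S assume "S \<in> {verts G}"
    then show "S \<in> sccs_verts" using r ne
      unfolding sccs_verts_def by (auto dest: reachable_in_verts)
  qed
  then show ?thesis by simp
qed

text \<open>
  Every vertex other than \<open>b\<close> contributes the first arc of a shortest walk to \<open>b\<close>; following these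
  arcs decreases the distance to \<open>b\<close>.
\<close>
lemma spanning_tree_arcs:
  assumes "connected G" "finite (verts G)" "b \<in> verts G"
  shows "\<exists>P \<subseteq> arcs G. finite P \<and> card P < card (verts G) \<and>
           (\<forall>v\<in>verts G. \<exists>p. awalk v p b \<and> set p \<subseteq> P)"
proof -
  define D where "D v = (LEAST n. \<exists>p. awalk v p b \<and> length p = n)" for v
  have D: "\<exists>p. awalk v p b \<and> length p = D v" if "v \<in> verts G" for v
    unfolding D_def by (rule LeastI_ex) (use connected_awalk[OF assms(1) that assms(3)] in blast)
  have "\<exists>a. a \<in> arcs G \<and> tail G a = v \<and> D (head G a) < D v" if v: "v \<in> verts G - {b}" for v
  proof -
    obtain p where p: "awalk v p b" "length p = D v" using D[of v] v by auto
    with v obtain a q where "p = a # q" by (cases p) (auto simp: awalk_Nil_iff)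
    with p have "a \<in> arcs G" "tail G a = v" "awalk (head G a) q b" "D v = Suc (length q)"
      by (auto simp: awalk_Cons_iff)
    moreover from this have "D (head G a) \<le> length q"
      unfolding D_def by (intro Least_le) auto
    ultimately show ?thesis by auto
  qed
  then obtain par where par: "par v \<in> arcs G" "tail G (par v) = v" "D (head G (par v)) < D v"
    if "v \<in> verts G - {b}" for v
    by metis
  let ?P = "par ` (verts G - {b})"
  have "\<exists>p. awalk v p b \<and> set p \<subseteq> ?P" if "v \<in> verts G" for v
    using that
  proof (induction "D v" arbitrary: v rule: less_induct)
    case less
    show ?case
    proof (cases "v = b")
      case True
      then show ?thesis using assms(3) by (intro exI[of _ "[]"]) (auto simp: awalk_Nil_iff)
    next
      case False
      with less.prems have v: "v \<in> verts G - {b}" by auto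
      then obtain p where "awalk (head G (par v)) p b" "set p \<subseteq> ?P"
        using less.hyps[of "head G (par v)"] par by auto
      then show ?thesis
        using par[OF v] v by (intro exI[of _ "par v # p"]) (auto simp: awalk_Cons_iff)
    qed
  qed
  moreover have "card ?P < card (verts G)"
    using card_image_le[of "verts G - {b}" par] assms card_Diff1_less[of "verts G" b] by auto
  ultimately show ?thesis
    using par assms(2) by (intro exI[of _ ?P]) auto
qed

end

section \<open>Graphs with cyclic fundamental group\<close>

locale cyclic_fundamental_group = serre_graph +
  fixes b and \<beta>
  assumes connected: "connected G"
    and loop: "awalk b \<beta> b"
    and loops_cyclic: "awalk b p b \<Longrightarrow> \<exists>k. homotopic b b p (loop_power \<beta> k)"
begin

lemma base_in_verts: "b \<in> verts G"
  using loop by auto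

lemma loop_arcs: "set \<beta> \<subseteq> arcs G"
  using loop by auto

text \<open>
  The multiplicity \<open>k\<close> is the same for all arcs \<open>e\<close>. A closed walk elsewhere is first joined to the
  base point by conjugation, which does not affect the counts.
\<close>
lemma closed_walk_degree:
  assumes "awalk u p u"
  obtains k where "\<And>e. e \<in> arcs G \<Longrightarrow> crossing e p = k * crossing e \<beta>"
    and "k = 1 \<Longrightarrow> freely_homotopic G rv (u, p) (b, \<beta>)"
proof -
  obtain s where s: "awalk b s u"
    using connected_awalk[OF connected base_in_verts] assms by auto
  then have "awalk b (s @ p @ rwalk s) b"
    using assms awalk_rwalk by (intro awalk_appendI)
  then obtain k where k: "homotopic b b (s @ p @ rwalk s) (loop_power \<beta> k)"
    using loops_cyclic by blast
  show ?thesis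
  proof
    fix e assume e: "e \<in> arcs G"
    have "set s \<subseteq> arcs G" using s by auto
    then show "crossing e p = k * crossing e \<beta>"
      using crossing_homotopic[OF k e] crossing_loop_power[OF loop_arcs e, of k]
        crossing_rwalk[of s e] e by simp
  next
    assume "k = 1"
    with k have "freely_homotopic G rv (b, s @ p @ rwalk s) (b, \<beta>)"
      by (simp add: homotopic_freely_homotopic)
    with freely_homotopic_conjugate[OF assms s] show "freely_homotopic G rv (u, p) (b, \<beta>)"
      unfolding freely_homotopic_def by (rule equivclp_trans)
  qed
qed

text \<open>
  The vectors of counts of \<open>p\<close> and \<open>q\<close> are multiples of that of \<open>\<beta>\<close>. By the first walk the entry of
  \<open>\<beta>\<close> at \<open>e\<close> is not zero, so the multiplicity of \<open>q\<close> is zero.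
\<close>
lemma crossings_dependent:
  assumes "awalk u p u" "awalk v q v" "e \<in> arcs G" "f \<in> arcs G"
    and "crossing e p = 1" "crossing e q = 0"
  shows "crossing f q = 0"
proof -
  obtain j where "\<And>e. e \<in> arcs G \<Longrightarrow> crossing e p = j * crossing e \<beta>"
    using closed_walk_degree[OF assms(1)] by blast
  moreover obtain k where "\<And>e. e \<in> arcs G \<Longrightarrow> crossing e q = k * crossing e \<beta>"
    using closed_walk_degree[OF assms(2)] by blast
  ultimately show ?thesis using assms(3-) by fastforce
qed

text \<open>
  If some edge \<open>e\<close> of \<open>p\<close> is not in \<open>q\<close>, then \<open>p\<close> traverses \<open>e\<close> once and \<open>q\<close> does not traverse it,
  although \<open>q\<close> traverses its own edges once.
\<close>
lemma circuit_unique: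
  assumes "circuit G rv p" "circuit G rv q"
  shows "set p \<union> rv ` set p = set q \<union> rv ` set q"
proof -
  have sub: "set p \<union> rv ` set p \<subseteq> set q \<union> rv ` set q"
    if p: "circuit G rv p" and q: "circuit G rv q" for p q
  proof (rule ccontr)
    assume neg: "\<not> ?thesis"
    obtain u where u: "awalk u p u" using p by (auto simp: circuit_def cycle_def)
    obtain v where v: "awalk v q v" "q \<noteq> []" using q by (auto simp: circuit_def cycle_def)
    have "rv ` (set q \<union> rv ` set q) \<subseteq> set q \<union> rv ` set q"
      using awalk_arcs[OF v(1)] by auto
    with neg obtain e where "e \<in> set p" "e \<notin> set q \<union> rv ` set q" by blast
    moreover from this have "rv e \<notin> set q"
      using awalk_arcs[OF u] by (metis UnCI image_eqI rv_rv subsetD)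
    ultimately have e: "e \<in> set p" "e \<notin> set q" "rv e \<notin> set q" by auto
    obtain f where f: "f \<in> set q" using v by (cases q) auto
    have "crossing f q = 0"
      using crossings_dependent[OF u v(1), of e f] e f u v crossing_circuit[OF p]
        crossing_not_in by auto
    with crossing_circuit[OF q f] show False by simp
  qed
  show ?thesis using sub assms by blast
qed

text \<open>
  A circuit traverses each of its edges once, so its multiplicity divides 1 and is 1 or -1. In the
  latter case the reversed circuit has multiplicity 1.
\<close>
lemma circuit_freely_homotopic:
  assumes p: "circuit G rv p" "awalk u p u"
  shows "freely_homotopic G rv (u, p) (b, \<beta>) \<or> freely_homotopic G rv (u, rwalk p) (b, \<beta>)"
proof -
  obtain e where e: "e \<in> set p" using p by (cases p) (auto simp: circuit_def cycle_def)
  have arcs: "set p \<subseteq> arcs G" "e \<in> arcs G" using p(2) e by auto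
  obtain j where j: "\<And>e. e \<in> arcs G \<Longrightarrow> crossing e p = j * crossing e \<beta>"
    and j1: "j = 1 \<Longrightarrow> freely_homotopic G rv (u, p) (b, \<beta>)"
    using closed_walk_degree[OF p(2)] by blast
  obtain k where k: "\<And>e. e \<in> arcs G \<Longrightarrow> crossing e (rwalk p) = k * crossing e \<beta>"
    and k1: "k = 1 \<Longrightarrow> freely_homotopic G rv (u, rwalk p) (b, \<beta>)"
    using closed_walk_degree[OF awalk_rwalk[OF p(2)]] by blast
  have "j * crossing e \<beta> = 1" "k * crossing e \<beta> = - 1"
    using j[OF arcs(2)] k[OF arcs(2)] crossing_rwalk[OF arcs] crossing_circuit[OF p(1) e] by auto
  then have "j = 1 \<or> k = 1"
    by (auto simp: zmult_eq_1_iff)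
  with j1 k1 show ?thesis by blast
qed

text \<open>
  Every edge \<open>e\<close> outside a spanning tree gives a closed walk that traverses \<open>e\<close> once and otherwise
  runs in the tree. Two such edges would contradict the dependence of counts, so at most one edge
  is added to the at most \<open>card (verts G) - 1\<close> edges of the tree.
\<close>
lemma card_edges_le:
  assumes "finite (verts G)" "finite (arcs G)"
  shows "card ((\<lambda>a. {a, rv a}) ` arcs G) \<le> card (verts G)"
proof -
  let ?E = "\<lambda>a. {a, rv a}"
  obtain P where P: "P \<subseteq> arcs G" "finite P" "card P < card (verts G)"
    and tree: "\<And>v. v \<in> verts G \<Longrightarrow> \<exists>p. awalk v p b \<and> set p \<subseteq> P"
    using spanning_tree_arcs[OF connected assms(1) base_in_verts] by blast
  have fundamental: "\<exists>q. awalk b q b \<and> crossing e q = 1 \<and>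
      (\<forall>f\<in>arcs G. ?E f \<notin> ?E ` P \<longrightarrow> ?E f \<noteq> ?E e \<longrightarrow> crossing f q = 0)"
    if e: "e \<in> arcs G" "?E e \<notin> ?E ` P" for e
  proof -
    obtain s t where s: "awalk (tail G e) s b" "set s \<subseteq> P" and t: "awalk (head G e) t b" "set t \<subseteq> P"
      using tree e wellformed by meson
    let ?q = "rwalk s @ [e] @ t"
    have zero: "crossing f s = 0" "crossing f t = 0" if "f \<in> arcs G" "?E f \<notin> ?E ` P" for f
    proof -
      have "f \<notin> P" "rv f \<notin> P" using that by (auto simp: image_iff)
      then show "crossing f s = 0" "crossing f t = 0"
        using s t by (auto intro!: crossing_not_in)
    qed
    have arcs: "set s \<subseteq> arcs G" using s P by auto
    have "awalk b ?q b"
      using s t e awalk_rwalk arc_implies_awalk by (intro awalk_appendI)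
    moreover have "crossing e ?q = 1"
      using zero[OF e] e crossing_rwalk[OF arcs] by (simp add: crossing_def)
    moreover have "crossing f ?q = 0" if "f \<in> arcs G" "?E f \<notin> ?E ` P" "?E f \<noteq> ?E e" for f
    proof -
      have "e \<noteq> f" "e \<noteq> rv f" using that e by auto
      then have "crossing f [e] = 0" by (intro crossing_not_in) auto
      then show ?thesis
        unfolding crossing_simps using zero[OF that(1,2)] crossing_rwalk[OF arcs that(1)] by simp
    qed
    ultimately show ?thesis by blast
  qed
  have one: "?E f = ?E e"
    if e: "e \<in> arcs G" "?E e \<notin> ?E ` P" and f: "f \<in> arcs G" "?E f \<notin> ?E ` P" for e f
  proof (rule ccontr)
    assume ne: "?E f \<noteq> ?E e"
    obtain p where p: "awalk b p b" "crossing e p = 1"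
      using fundamental[OF e] by blast
    obtain q where q: "awalk b q b" "crossing f q = 1" "crossing e q = 0"
      using fundamental[OF f] e ne[symmetric] by blast
    show False
      using crossings_dependent[OF p(1) q(1) e(1) f(1) p(2) q(3)] q(2) by simp
  qed
  have "\<exists>x. ?E ` arcs G \<subseteq> insert x (?E ` P)"
  proof (cases "?E ` arcs G \<subseteq> ?E ` P")
    case False
    then obtain e where "e \<in> arcs G" "?E e \<notin> ?E ` P" by blast
    with one have "?E ` arcs G \<subseteq> insert (?E e) (?E ` P)" by blast
    then show ?thesis ..
  qed blast
  then obtain x where "?E ` arcs G \<subseteq> insert x (?E ` P)" ..
  then have "card (?E ` arcs G) \<le> card (insert x (?E ` P))"
    using P by (intro card_mono) auto
  also have "\<dots> \<le> Suc (card P)"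
    using P card_image_le[of P ?E] by (auto simp: card_insert_if intro: le_SucI)
  finally show ?thesis using P by simp
qed

lemma cyclomatic_number_le_1:
  assumes "finite (verts G)" "finite (arcs G)"
  shows "cyclomatic_number G rv \<le> 1"
  using card_edges_le[OF assms] card_sccs_verts_connected[OF connected]
  by (simp add: cyclomatic_number_def)

lemma tree_or_unicyclic:
  assumes "bidirected_digraph G rv"
  shows "serre_tree G rv \<or> unicyclic G rv"
proof (cases "\<exists>p. circuit G rv p")
  case True
  then obtain p where "circuit G rv p" ..
  then have "\<exists>!C. \<exists>p. circuit G rv p \<and> C = set p \<union> rv ` set p"
    by (intro ex1I[of _ "set p \<union> rv ` set p"]) (auto dest: circuit_unique)
  then show ?thesis
    using assms connected by (simp add: unicyclic_def)
next
  case False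
  then show ?thesis
    using assms connected by (simp add: serre_tree_def)
qed

end

section \<open>Automorphisms of a tree\<close>

locale simplicial_tree =
  fixes X :: "'a pair_pre_digraph"
  assumes tree: "is_tree X"

sublocale simplicial_tree \<subseteq> circuit_free "with_proj X" prod.swap
proof -
  interpret B: bidirected_digraph "with_proj X" "swap_in (parcs X)"
    using tree by (simp add: is_tree_def serre_tree_def)
  show "circuit_free (with_proj X) prod.swap"
  proof
    fix a assume a: "a \<in> arcs (with_proj X)"
    then have sw: "swap_in (parcs X) a = prod.swap a"
      by (simp add: swap_in_def)
    show "prod.swap a \<in> arcs (with_proj X)" "prod.swap a \<noteq> a"
      "tail (with_proj X) (prod.swap a) = head (with_proj X) a"
      using B.arev_in_arcs[OF a] B.arev_neq[OF a] B.tail_arev[OF a] sw by auto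
    show "prod.swap (prod.swap a) = a" by simp
  next
    show "connected (with_proj X)"
      using tree by (simp add: is_tree_def serre_tree_def)
  next
    fix p
    show "\<not> circuit (with_proj X) prod.swap p"
    proof
      assume "circuit (with_proj X) prod.swap p"
      then have p: "B.cycle p" "\<And>a. p \<noteq> [a, prod.swap a]" by (auto simp: circuit_def)
      have "p \<noteq> [a, swap_in (parcs X) a]" for a
        using p by (auto simp: B.cycle_def swap_in_def B.awalk_Cons_iff)
      then have "circuit (with_proj X) (swap_in (parcs X)) p"
        using p by (simp add: circuit_def)
      then show False
        using tree by (auto simp: is_tree_def serre_tree_def)
    qed
  qed
qed

text \<open>
  An automorphism is given by its action on vertices; this is the induced action on walks.
\<close>
definition act :: "('a \<Rightarrow> 'a) \<Rightarrow> ('a \<times> 'a) list \<Rightarrow> ('a \<times> 'a) list" where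
  "act f = map (map_prod f f)"

lemma act_simps [simp]:
  "act f [] = []" "act f (a # p) = map_prod f f a # act f p" "act f (p @ q) = act f p @ act f q"
  "length (act f p) = length p" "act f p = [] \<longleftrightarrow> p = []" "set (act f p) = map_prod f f ` set p"
  by (auto simp: act_def)

lemma swap_map_prod: "prod.swap (map_prod f f a) = map_prod f f (prod.swap a)"
  by (cases a) simp

context simplicial_tree
begin

abbreviation (input) Aut :: "('a \<Rightarrow> 'a) set" where
  "Aut \<equiv> carrier (aut_group X)"

abbreviation (input) dist :: "'a \<Rightarrow> 'a \<Rightarrow> nat" where
  "dist \<equiv> graph_dist X"

lemma arc_ends: "a \<in> parcs X \<Longrightarrow> fst a \<in> pverts X" "a \<in> parcs X \<Longrightarrow> snd a \<in> pverts X"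
  using tail_in_verts[of a] head_in_verts[of a] by auto

lemma walk_arcs: "awalk u p v \<Longrightarrow> set p \<subseteq> parcs X"
  using awalk_arcs[of u p v] by simp

lemma swap_in_parcs: "a \<in> parcs X \<Longrightarrow> prod.swap a \<in> parcs X"
  using rv_in_arcs[of a] by simp

lemma aut_vert: "f \<in> Aut \<Longrightarrow> v \<in> pverts X \<Longrightarrow> f v \<in> pverts X"
  by (auto simp: aut_group_def dest: Bij_imp_funcset)

lemma aut_inj: "f \<in> Aut \<Longrightarrow> u \<in> pverts X \<Longrightarrow> v \<in> pverts X \<Longrightarrow> f u = f v \<longleftrightarrow> u = v"
  by (auto simp: aut_group_def Bij_def bij_betw_def inj_on_def)

lemma aut_arc: "f \<in> Aut \<Longrightarrow> a \<in> parcs X \<Longrightarrow> map_prod f f a \<in> parcs X"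
  using arc_ends[of a] by (cases a) (auto simp: aut_group_def)

lemma aut_arc_inj:
  "f \<in> Aut \<Longrightarrow> a \<in> parcs X \<Longrightarrow> b \<in> parcs X \<Longrightarrow> map_prod f f a = map_prod f f b \<longleftrightarrow> a = b"
  using arc_ends[of a] arc_ends[of b] aut_inj by (cases a; cases b) auto

lemma group_aut: "group (aut_group X)"
proof -
  interpret B: group "BijGroup (pverts X)" by (rule group_BijGroup)
  let ?H = "{f \<in> Bij (pverts X). \<forall>u\<in>pverts X. \<forall>v\<in>pverts X.
        (f u, f v) \<in> parcs X \<longleftrightarrow> (u, v) \<in> parcs X}"
  have "subgroup ?H (BijGroup (pverts X))"
  proof (rule B.subgroupI)
    show "?H \<subseteq> carrier (BijGroup (pverts X))" by (auto simp: BijGroup_def)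
    have "(\<lambda>x\<in>pverts X. x) \<in> ?H" by (auto simp: id_Bij)
    then show "?H \<noteq> {}" by blast
  next
    fix f assume f: "f \<in> ?H"
    then have fB: "f \<in> Bij (pverts X)" by simp
    have inv: "inv\<^bsub>BijGroup (pverts X)\<^esub> f = (\<lambda>x\<in>pverts X. inv_into (pverts X) f x)"
      using fB by (rule inv_BijGroup)
    have "f ` pverts X = pverts X" using fB by (auto simp: Bij_def bij_betw_def)
    then have i: "inv_into (pverts X) f v \<in> pverts X" "f (inv_into (pverts X) f v) = v"
      if "v \<in> pverts X" for v
      using that by (auto intro: inv_into_into f_inv_into_f)
    show "inv\<^bsub>BijGroup (pverts X)\<^esub> f \<in> ?H"
      unfolding inv using restrict_inv_into_Bij[OF fB] i f
      by auto (metis i)+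
  next
    fix f k assume "f \<in> ?H" "k \<in> ?H"
    then show "f \<otimes>\<^bsub>BijGroup (pverts X)\<^esub> k \<in> ?H"
      by (auto simp: BijGroup_def compose_Bij) (auto simp: compose_def dest: Bij_imp_funcset)
  qed
  then show ?thesis
    unfolding aut_group_def by (rule B.subgroup_imp_group)
qed

lemma aut_mult:
  "f \<in> Aut \<Longrightarrow> k \<in> Aut \<Longrightarrow> v \<in> pverts X \<Longrightarrow> (f \<otimes>\<^bsub>aut_group X\<^esub> k) v = f (k v)"
  by (auto simp: aut_group_def BijGroup_def compose_def)

lemma aut_one: "v \<in> pverts X \<Longrightarrow> \<one>\<^bsub>aut_group X\<^esub> v = v"
  by (auto simp: aut_group_def BijGroup_def)

lemma aut_inv:
  assumes "f \<in> Aut"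
  shows "inv\<^bsub>aut_group X\<^esub> f \<in> Aut"
    and "v \<in> pverts X \<Longrightarrow> (inv\<^bsub>aut_group X\<^esub> f) (f v) = v"
    and "v \<in> pverts X \<Longrightarrow> f ((inv\<^bsub>aut_group X\<^esub> f) v) = v"
proof -
  interpret A: group "aut_group X" by (rule group_aut)
  show i: "inv\<^bsub>aut_group X\<^esub> f \<in> Aut" using assms by simp
  show "v \<in> pverts X \<Longrightarrow> (inv\<^bsub>aut_group X\<^esub> f) (f v) = v"
    using aut_mult[OF i assms] assms aut_one by simp
  show "v \<in> pverts X \<Longrightarrow> f ((inv\<^bsub>aut_group X\<^esub> f) v) = v"
    using aut_mult[OF assms i] assms aut_one by simp
qed

lemma act_arcs: "f \<in> Aut \<Longrightarrow> set p \<subseteq> parcs X \<Longrightarrow> set (act f p) \<subseteq> parcs X"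
  using aut_arc by auto

lemma act_mult:
  assumes "f \<in> Aut" "k \<in> Aut" "set p \<subseteq> parcs X"
  shows "act (f \<otimes>\<^bsub>aut_group X\<^esub> k) p = act f (act k p)"
proof -
  have "map_prod (f \<otimes>\<^bsub>aut_group X\<^esub> k) (f \<otimes>\<^bsub>aut_group X\<^esub> k) a = map_prod f f (map_prod k k a)"
    if "a \<in> parcs X" for a
    using arc_ends[OF that] aut_mult[OF assms(1,2)] by (cases a) simp
  with assms(3) show ?thesis by (auto simp: act_def simp del: map_prod_simp)
qed

lemma act_inv:
  assumes "f \<in> Aut" "set p \<subseteq> parcs X"
  shows "act (inv\<^bsub>aut_group X\<^esub> f) (act f p) = p" "act f (act (inv\<^bsub>aut_group X\<^esub> f) p) = p"
proof -
  let ?k = "inv\<^bsub>aut_group X\<^esub> f"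
  have "map_prod ?k ?k (map_prod f f a) = a" "map_prod f f (map_prod ?k ?k a) = a" if "a \<in> parcs X" for a
    using arc_ends[OF that] aut_inv(2,3)[OF assms(1)] by (cases a; simp)+
  with assms(2) show "act ?k (act f p) = p" "act f (act ?k p) = p"
    by (auto simp: act_def subset_iff intro!: map_idI simp del: map_prod_simp)
qed

lemma awalk_act:
  assumes "f \<in> Aut" "awalk u p v"
  shows "awalk (f u) (act f p) (f v)"
  using assms(2)
  by (induction p arbitrary: u)
    (auto simp: awalk_Nil_iff awalk_Cons_iff aut_vert[OF assms(1)] intro: aut_arc[OF assms(1), of "(_, _)", simplified])

lemma rwalk_act: "rwalk (act f p) = act f (rwalk p)"
  by (induction p) (auto simp: swap_map_prod)

lemma hd_act: "p \<noteq> [] \<Longrightarrow> hd (act f p) = map_prod f f (hd p)"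
  and last_act: "p \<noteq> [] \<Longrightarrow> last (act f p) = map_prod f f (last p)"
  by (auto simp: act_def hd_map last_map)

lemma reduced_act:
  assumes "f \<in> Aut" "set p \<subseteq> parcs X" "reduced p"
  shows "reduced (act f p)"
  using assms(2,3)
proof (induction p)
  case (Cons a p)
  then show ?case
    using aut_arc_inj[OF assms(1), of "hd p" "prod.swap a"] swap_in_parcs[of a]
    by (cases p) (auto simp: reduced_Cons_iff swap_map_prod)
qed simp

lemma graph_dist_le: "awalk u p v \<Longrightarrow> dist u v \<le> length p"
  unfolding graph_dist_def by (rule Least_le) auto

lemma reduced_walk_dist:
  assumes "awalk u p v" "reduced p"
  shows "dist u v = length p"
  unfolding graph_dist_def using assms reduced_walk_shortest
  by (intro Least_equality) auto

lemma reduced_walk_dist_exists: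
  assumes "u \<in> pverts X" "v \<in> pverts X"
  obtains p where "awalk u p v" "reduced p" "length p = dist u v"
  using reduced_walk_exists[of u v] reduced_walk_dist assms by auto

lemma dist_self: "v \<in> pverts X \<Longrightarrow> dist v v = 0"
  using graph_dist_le[of v "[]" v] by (simp add: awalk_Nil_iff)

lemma dist_triangle:
  assumes "u \<in> pverts X" "v \<in> pverts X" "w \<in> pverts X"
  shows "dist u w \<le> dist u v + dist v w"
proof -
  obtain p where p: "awalk u p v" "length p = dist u v"
    using reduced_walk_dist_exists[OF assms(1,2)] by blast
  obtain q where q: "awalk v q w" "length q = dist v w"
    using reduced_walk_dist_exists[OF assms(2,3)] by blast
  show ?thesis
    using graph_dist_le[OF awalk_appendI[OF p(1) q(1)]] p q by simp
qed

lemma dist_commute: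
  assumes "u \<in> pverts X" "v \<in> pverts X"
  shows "dist u v = dist v u"
proof -
  obtain p where p: "awalk u p v" "reduced p" "length p = dist u v"
    using reduced_walk_dist_exists[OF assms] by blast
  then have "dist v u = length (rwalk p)"
    by (intro reduced_walk_dist awalk_rwalk reduced_rwalk awalk_arcs)
  with p show ?thesis by simp
qed

lemma dist_act:
  assumes "f \<in> Aut" "u \<in> pverts X" "v \<in> pverts X"
  shows "dist (f u) (f v) = dist u v"
proof -
  obtain p where p: "awalk u p v" "reduced p" "length p = dist u v"
    using reduced_walk_dist_exists[OF assms(2,3)] by blast
  then have "dist (f u) (f v) = length (act f p)"
    by (intro reduced_walk_dist awalk_act[OF assms(1)] reduced_act[OF assms(1)] walk_arcs)
  with p show ?thesis by simp
qed

lemma funpow_vert: "f \<in> Aut \<Longrightarrow> v \<in> pverts X \<Longrightarrow> (f ^^ n) v \<in> pverts X"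
  by (induction n) (auto intro: aut_vert)

lemma dist_funpow:
  assumes "f \<in> Aut" "u \<in> pverts X" "v \<in> pverts X"
  shows "dist ((f ^^ n) u) ((f ^^ n) v) = dist u v"
  by (induction n) (simp_all add: assms dist_act[OF assms(1)] funpow_vert[OF assms(1)])

lemma dist_funpow_le:
  assumes "f \<in> Aut" "v \<in> pverts X"
  shows "dist v ((f ^^ n) v) \<le> n * dist v (f v)"
proof (induction n)
  case 0
  then show ?case using assms dist_self by simp
next
  case (Suc n)
  have "dist v ((f ^^ Suc n) v) \<le> dist v (f v) + dist (f v) (f ((f ^^ n) v))"
    using assms aut_vert[OF assms(1)] funpow_vert[OF assms] by (simp add: dist_triangle)
  with Suc show ?case using assms funpow_vert[OF assms] by (simp add: dist_act)
qed

section \<open>Translations along an axis\<close>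

text \<open>
  The geodesic \<open>s\<close> from \<open>x\<close> to \<open>f x\<close> continues without backtracking to \<open>f (f x)\<close>, so that its
  translates under the powers of \<open>f\<close> form a bi-infinite geodesic.
\<close>
definition translates :: "('a \<Rightarrow> 'a) \<Rightarrow> 'a \<Rightarrow> ('a \<times> 'a) list \<Rightarrow> bool" where
  "translates f x s \<longleftrightarrow> awalk x s (f x) \<and> s \<noteq> [] \<and> reduced (s @ act f s)"

primrec line :: "('a \<Rightarrow> 'a) \<Rightarrow> ('a \<times> 'a) list \<Rightarrow> nat \<Rightarrow> ('a \<times> 'a) list" where
  "line f s 0 = []"
| "line f s (Suc n) = s @ act f (line f s n)"

lemma line_walk:
  assumes f: "f \<in> Aut" and s: "translates f x s"
  shows "awalk x (line f s n) ((f ^^ n) x)" "reduced (line f s n)"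
    "length (line f s n) = n * length s" "n > 0 \<Longrightarrow> hd (line f s n) = hd s"
proof (induction n)
  case 0
  { case 1 show ?case using s by (auto simp: translates_def awalk_Nil_iff) }
  { case 2 show ?case by simp }
  { case 3 show ?case by simp }
  { case 4 then show ?case by simp }
next
  case (Suc n)
  { case 1
    have "awalk x (s @ act f (line f s n)) (f ((f ^^ n) x))"
      using s awalk_act[OF f Suc.IH(1)] by (intro awalk_appendI) (auto simp: translates_def)
    then show ?case by simp }
  { case 2
    have l: "reduced (act f (line f s n))"
      using Suc.IH by (intro reduced_act[OF f] walk_arcs)
    have "hd (act f (line f s n)) = hd (act f s)" if "n > 0"
      using Suc.IH(3,4) that s by (subst (1 2) hd_act) (auto simp: translates_def)
    then show ?case
      using s l by (cases n) (auto simp: translates_def reduced_append_iff) }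
  { case 3 show ?case using Suc.IH by simp }
  { case 4 show ?case using s by (simp add: translates_def) }
qed

text \<open>
  The powers of \<open>f\<close> move \<open>x\<close> along a geodesic, hence by exactly \<open>n * length s\<close>; any other vertex \<open>y\<close>
  differs from \<open>x\<close> by a bounded amount.
\<close>
lemma translates_progress:
  assumes f: "f \<in> Aut" and s: "translates f x s" and y: "y \<in> pverts X"
  shows "n * length s \<le> 2 * dist x y + dist y ((f ^^ n) y)"
proof -
  have x: "x \<in> pverts X" using s awalk_hd_in_verts[of x s] by (auto simp: translates_def)
  note fy = funpow_vert[OF f y, of n] and fx = funpow_vert[OF f x, of n]
  have "n * length s = dist x ((f ^^ n) x)"
    using line_walk[OF f s] reduced_walk_dist by metis
  also have "\<dots> \<le> dist x y + dist y ((f ^^ n) x)"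
    using x y fx by (rule dist_triangle)
  also have "\<dots> \<le> dist x y + (dist y ((f ^^ n) y) + dist ((f ^^ n) y) ((f ^^ n) x))"
    using dist_triangle[OF y fy fx] by simp
  also have "dist ((f ^^ n) y) ((f ^^ n) x) = dist x y"
    using dist_funpow[OF f y x] dist_commute[OF x y] by simp
  finally show ?thesis by simp
qed

text \<open>
  As \<open>n\<close> grows, the displacement of \<open>y\<close> under \<open>f ^^ n\<close> grows at least like \<open>n * length s\<close>, but at
  most like \<open>n * dist y (f y)\<close>.
\<close>
lemma translates_length_le:
  assumes f: "f \<in> Aut" and s: "translates f x s" and y: "y \<in> pverts X"
  shows "length s \<le> dist y (f y)"
proof (rule ccontr)
  assume "\<not> ?thesis"
  then have "Suc (dist y (f y)) \<le> length s" by simp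
  \<comment> \<open>The first exponent for which the linear growth exceeds the error \<open>2 * dist x y\<close>.\<close>
  let ?n = "2 * dist x y + 1"
  have "?n * Suc (dist y (f y)) \<le> ?n * length s"
    using \<open>Suc _ \<le> _\<close> by (rule mult_le_mono2)
  also have "\<dots> \<le> 2 * dist x y + ?n * dist y (f y)"
    using translates_progress[OF f s y, of ?n] dist_funpow_le[OF f y, of ?n] by linarith
  finally show False by simp
qed

text \<open>
  A vertex \<open>z\<close> on \<open>s\<close> is joined to \<open>f z\<close> by the rest of \<open>s\<close> followed by the image of the beginning
  of \<open>s\<close>, which again has the length of \<open>s\<close>.
\<close>
lemma translates_displacement:
  assumes f: "f \<in> Aut" and s: "awalk x s (f x)" and a: "a \<in> set s"
  shows "dist (fst a) (f (fst a)) \<le> length s" "dist (snd a) (f (snd a)) \<le> length s"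
proof -
  have split: "dist z (f z) \<le> length s" if "awalk x s1 z" "awalk z s2 (f x)" "s = s1 @ s2" for z s1 s2
    using graph_dist_le[OF awalk_appendI[OF that(2) awalk_act[OF f that(1)]]] that(3) by simp
  obtain s1 s2 where "s = s1 @ a # s2" using a by (meson split_list)
  then have *: "awalk x s1 (fst a)" "awalk (snd a) s2 (f x)" "a \<in> parcs X" "s = (s1 @ [a]) @ s2"
    using s by (auto simp: awalk_append_split awalk_Cons_iff simp del: awalk_append_iff)
  show "dist (fst a) (f (fst a)) \<le> length s"
    using * by (intro split[of s1 _ "a # s2"]) (auto simp: awalk_Cons_iff)
  show "dist (snd a) (f (snd a)) \<le> length s"
    using * arc_implies_awalk[of a]
    by (intro split[of "s1 @ [a]" _ s2]) (auto intro: awalk_appendI simp del: awalk_append_iff)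
qed

lemma translation_length_le: "v \<in> pverts X \<Longrightarrow> translation_length X f \<le> dist v (f v)"
  unfolding translation_length_def by (rule Least_le) auto

text \<open>
  All displacements are at least \<open>length s\<close>, so there is no fixed vertex. If an edge were inverted,
  then the even powers of \<open>f\<close> would fix a vertex, contradicting the linear growth of displacements.
\<close>
lemma translates_hyperbolic:
  assumes f: "f \<in> Aut" and s: "translates f x s"
  shows "hyperbolic X f" "translation_length X f = length s" "set s \<subseteq> parcs (axis X f)"
    "(fst ` set s) \<union> (snd ` set s) \<subseteq> pverts (axis X f)"
proof -
  have walk: "awalk x s (f x)" "s \<noteq> []" "reduced s" and x: "x \<in> pverts X"
    using s awalk_hd_in_verts[of x s] by (auto simp: translates_def reduced_append_iff)
  have "\<not> elliptic X f"
  proof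
    assume "elliptic X f"
    then obtain v where v: "v \<in> pverts X" "f v = v" by (auto simp: elliptic_def fixed_verts_def)
    with translates_length_le[OF f s v(1)] dist_self walk show False by simp
  qed
  moreover have "\<not> inverts_edge X f"
  proof
    assume "inverts_edge X f"
    then obtain u v where u: "(u, v) \<in> parcs X" "f u = v" "f v = u"
      by (auto simp: inverts_edge_def)
    then have ux: "u \<in> pverts X" using arc_ends[of "(u, v)"] by simp
    have "(f ^^ 2) u = u" using u by (simp add: numeral_2_eq_2)
    then have per: "(f ^^ (2 * k)) u = u" for k
    proof (induction k)
      case (Suc k)
      have "(f ^^ (2 * Suc k)) u = (f ^^ (2 * k)) ((f ^^ 2) u)"
        by (simp only: mult_Suc_right funpow_add comp_apply add.commute[of 2])
      with Suc \<open>(f ^^ 2) u = u\<close> show ?case by simp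
    qed simp
    have "2 * (dist x u + 1) * 1 \<le> 2 * (dist x u + 1) * length s"
      using walk by (intro mult_le_mono2) (cases s, auto)
    also have "\<dots> \<le> 2 * dist x u + dist u u"
      using translates_progress[OF f s ux, of "2 * (dist x u + 1)"] per[of "dist x u + 1"] by simp
    finally show False using dist_self[OF ux] by simp
  qed
  ultimately show "hyperbolic X f" by (simp add: hyperbolic_def)
  show len: "translation_length X f = length s"
    unfolding translation_length_def
    using translates_length_le[OF f s] x reduced_walk_dist[OF walk(1,3)]
    by (intro Least_equality) auto
  have ends: "fst a \<in> pverts X" "snd a \<in> pverts X" "a \<in> parcs X" if "a \<in> set s" for a
    using that walk_arcs[OF walk(1)] arc_ends[of a] by auto
  have on_axis: "fst a \<in> pverts (axis X f)" "snd a \<in> pverts (axis X f)" if a: "a \<in> set s" for a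
    using translates_displacement[OF f walk(1) a] ends[OF a] len
      translates_length_le[OF f s, of "fst a"] translates_length_le[OF f s, of "snd a"]
    by (simp_all add: axis_def Let_def)
  then show "(fst ` set s) \<union> (snd ` set s) \<subseteq> pverts (axis X f)"
    by auto
  show "set s \<subseteq> parcs (axis X f)"
  proof
    fix a assume a: "a \<in> set s"
    then show "a \<in> parcs (axis X f)"
      using on_axis[OF a] ends[OF a] by (simp add: axis_def Let_def mem_Times_iff)
  qed
qed

text \<open>
  Conversely, let \<open>x\<close> have minimal displacement. If \<open>s\<close> followed by \<open>f s\<close> backtracks, then \<open>f\<close> maps
  the first arc \<open>a\<close> of \<open>s\<close> to the reverse of the last one. When \<open>s\<close> is a single arc, this is an
  inversion; otherwise the second vertex of \<open>s\<close> is moved to the last but one, hence less than \<open>x\<close>.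
\<close>
lemma hyperbolic_translates:
  assumes f: "f \<in> Aut" and h: "hyperbolic X f" and x: "x \<in> pverts (axis X f)"
  obtains s where "translates f x s" "length s = translation_length X f"
proof -
  have xX: "x \<in> pverts X" and tl: "dist x (f x) = translation_length X f"
    using x by (auto simp: axis_def Let_def)
  obtain s where s: "awalk x s (f x)" "reduced s" "length s = dist x (f x)"
    using reduced_walk_dist_exists[OF xX aut_vert[OF f xX]] by blast
  have "s \<noteq> []"
  proof
    assume "s = []"
    with s have "f x = x" by (simp add: awalk_Nil_iff)
    with xX h show False by (auto simp: hyperbolic_def elliptic_def fixed_verts_def)
  qed
  have "reduced (act f s)" using s by (intro reduced_act[OF f] walk_arcs)
  moreover have "hd (act f s) \<noteq> prod.swap (last s)"
  proof
    assume eq: "hd (act f s) = prod.swap (last s)"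
    obtain a s' where a: "s = a # s'" using \<open>s \<noteq> []\<close> by (cases s) auto
    have aX: "a \<in> parcs X" using s a by auto
    show False
    proof (cases "s' = []")
      case True
      with eq a have "map_prod f f a = prod.swap a" by simp
      then have "f (fst a) = snd a" "f (snd a) = fst a"
        by (cases a; simp)+
      with aX h show False by (cases a) (auto simp: hyperbolic_def inverts_edge_def)
    next
      case False
      then obtain t b where t: "s' = t @ [b]" by (cases s' rule: rev_cases) auto
      have walk: "awalk (snd a) t (fst b)"
        using s(1) a t by (auto simp: awalk_append_split awalk_Cons_iff simp del: awalk_append_iff)
      have "map_prod f f a = prod.swap b" using eq a t by simp
      then have "f (snd a) = fst b" by (cases a; cases b) simp
      with walk have "dist (snd a) (f (snd a)) \<le> length t"
        using graph_dist_le by simp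
      with translation_length_le[of "snd a" f] arc_ends(2)[OF aX] tl s a t show False
        by simp
    qed
  qed
  ultimately have "translates f x s"
    using s \<open>s \<noteq> []\<close> by (simp add: translates_def reduced_append_iff)
  then show ?thesis using that s tl by simp
qed

text \<open>
  The inverse of \<open>f\<close> translates along the same line in the opposite direction.
\<close>
lemma translates_inverse:
  assumes f: "f \<in> Aut" and s: "translates f x s"
  shows "translates (inv\<^bsub>aut_group X\<^esub> f) x (rwalk (act (inv\<^bsub>aut_group X\<^esub> f) s))"
proof -
  let ?k = "inv\<^bsub>aut_group X\<^esub> f"
  have k: "?k \<in> Aut" using aut_inv[OF f] by blast
  have walk: "awalk x s (f x)" and ne: "s \<noteq> []" and red: "reduced (s @ act f s)"
    and arcs: "set s \<subseteq> parcs X" and x: "x \<in> pverts X"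
    using s awalk_hd_in_verts[of x s] walk_arcs[of x s "f x"] by (auto simp: translates_def)
  have "awalk (?k x) (act ?k s) x"
    using awalk_act[OF k walk] aut_inv(2)[OF f x] by simp
  then have "awalk x (rwalk (act ?k s)) (?k x)" by (rule awalk_rwalk)
  moreover have "rwalk (act ?k s) @ act ?k (rwalk (act ?k s)) = rwalk (act ?k (act ?k (s @ act f s)))"
    using act_inv[OF f arcs] by (simp add: rwalk_act)
  moreover have "reduced (rwalk (act ?k (act ?k (s @ act f s))))"
    using red arcs act_arcs[OF f arcs] act_arcs[OF k, of "s @ act f s"]
      act_arcs[OF k, of "act ?k (s @ act f s)"]
    by (intro reduced_rwalk reduced_act[OF k]) (simp_all add: aut_arc[OF k] image_subset_iff subset_iff)
  ultimately show ?thesis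
    using ne unfolding translates_def by (metis act_simps(5) rwalk_simps(5))
qed

text \<open>
  Let \<open>x\<close> be on the axis and \<open>b\<close> in the invariant set \<open>B\<close>. For large \<open>n\<close>, the translates of \<open>b\<close> under
  the \<open>n\<close>-th powers of \<open>f\<close> and of its inverse are seen from \<open>x\<close> in the two different directions of
  the axis. So the geodesic between them, which runs within \<open>A\<close>, passes through \<open>x\<close>.
\<close>
lemma axis_in_invariant_subgraph:
  assumes f: "f \<in> Aut" and h: "hyperbolic X f"
    and b: "b \<in> B" and BX: "B \<subseteq> pverts X"
    and inv: "\<And>v. v \<in> B \<Longrightarrow> f v \<in> B" "\<And>v. v \<in> B \<Longrightarrow> (inv\<^bsub>aut_group X\<^esub> f) v \<in> B"
    and conn: "\<And>u v. u \<in> B \<Longrightarrow> v \<in> B \<Longrightarrow> \<exists>p. awalk u p v \<and> set p \<subseteq> A"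
    and AB: "fst ` A \<subseteq> B"
  shows "pverts (axis X f) \<subseteq> B" "parcs (axis X f) \<subseteq> A"
proof -
  let ?k = "inv\<^bsub>aut_group X\<^esub> f"
  have k: "?k \<in> Aut" using aut_inv[OF f] by blast
  have geodesic: "set p \<subseteq> A" if "awalk u p v" "reduced p" "u \<in> B" "v \<in> B" for u p v
    using conn[OF that(3,4)] reduced_walk_shortest(2)[OF that(1,2)] by blast
  have toward: "\<exists>p. awalk x p ((m ^^ n) b) \<and> reduced p \<and> p \<noteq> [] \<and> hd p = hd s"
    if m: "m \<in> Aut" and s: "translates m x s" and n: "n = dist x b + 1" for m x s n
  proof -
    have x: "x \<in> pverts X" using s awalk_hd_in_verts[of x s] by (auto simp: translates_def)
    note mx = funpow_vert[OF m x, of n] and mb = funpow_vert[OF m subsetD[OF BX b], of n]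
    obtain q where q: "awalk ((m ^^ n) x) q ((m ^^ n) b)" "length q = dist x b"
      using reduced_walk_dist_exists[OF mx mb] dist_funpow[OF m x subsetD[OF BX b], of n] by metis
    have "length s > 0" using s by (simp add: translates_def)
    then have "length q < length (line m s n)"
      using q n line_walk(3)[OF m s, of n] by (cases "length s") auto
    from first_arc_persists[OF line_walk(1,2)[OF m s] q(1) this]
    show ?thesis using line_walk(4)[OF m s, of n] n by simp
  qed
  have fB: "(f ^^ n) v \<in> B" "(?k ^^ n) v \<in> B" if "v \<in> B" for n v
    by (induction n) (auto simp: inv that)
  show verts: "pverts (axis X f) \<subseteq> B"
  proof
    fix x assume "x \<in> pverts (axis X f)"
    then obtain s where s: "translates f x s"
      using hyperbolic_translates[OF f h] by blast
    \<comment> \<open>The power moves \<open>x\<close> by at least \<open>n\<close>, which is more than the distance from \<open>x\<close> to \<open>b\<close>.\<close>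
    define n where "n = dist x b + 1"
    obtain p where p: "awalk x p ((f ^^ n) b)" "reduced p" "p \<noteq> []" "hd p = hd s"
      using toward[OF f s n_def] by blast
    obtain q where q: "awalk x q ((?k ^^ n) b)" "reduced q" "q \<noteq> []"
        "hd q = hd (rwalk (act ?k s))"
      using toward[OF k translates_inverse[OF f s] n_def] by blast
    have s': "awalk x s (f x)" "s \<noteq> []" "reduced (s @ act f s)" "set s \<subseteq> parcs X"
      using s walk_arcs[of x s "f x"] by (simp_all add: translates_def)
    have "hd q = prod.swap (map_prod ?k ?k (last s))"
      using q(4) s'(2) by (simp add: rwalk_def hd_rev last_map last_act)
    moreover have "map_prod ?k ?k (map_prod f f (hd s)) = hd s"
      using act_inv(1)[OF f s'(4)] s'(2) by (cases s) auto
    moreover have "map_prod f f (hd s) \<noteq> prod.swap (last s)"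
      using s' by (auto simp: reduced_append_iff hd_act)
    moreover have "map_prod f f (hd s) \<in> parcs X" "prod.swap (last s) \<in> parcs X"
      using s'(2,4) by (auto intro!: aut_arc[OF f] swap_in_parcs simp del: map_prod_simp swap_simp)
    ultimately have "hd q \<noteq> hd s"
      using aut_arc_inj[OF k] by (metis swap_map_prod)
    moreover have "last (rwalk q) = prod.swap (hd q)"
      using q(3) by (cases q) auto
    ultimately have "reduced (rwalk q @ p)"
      using p q reduced_rwalk[of q] awalk_arcs[OF q(1)] by (auto simp: reduced_append_iff)
    moreover have "awalk ((?k ^^ n) b) (rwalk q @ p) ((f ^^ n) b)"
      using awalk_appendI[OF awalk_rwalk[OF q(1)] p(1)] .
    ultimately have "set (rwalk q @ p) \<subseteq> A"
      using geodesic fB b by blast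
    then have "hd p \<in> A" using p(3) by auto
    moreover have "fst (hd p) = x" using p(1,3) by (cases p) (auto simp: awalk_Cons_iff)
    ultimately show "x \<in> B" using AB by blast
  qed
  show "parcs (axis X f) \<subseteq> A"
  proof
    fix a assume a: "a \<in> parcs (axis X f)"
    then have "a \<in> parcs X" "fst a \<in> pverts (axis X f)" "snd a \<in> pverts (axis X f)"
      by (auto simp: axis_def Let_def)
    then have "set [a] \<subseteq> A"
      using verts arc_implies_awalk[of a] by (intro geodesic[of "fst a" "[a]" "snd a"]) auto
    then show "a \<in> A" by simp
  qed
qed

end

section \<open>Groups generated by two automorphisms\<close>

lemma (in serre_graph) connectedI:
  assumes "b \<in> verts G" "\<And>v. v \<in> verts G \<Longrightarrow> \<exists>p. awalk b p v"
  shows "connected G"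
proof -
  have "u \<rightarrow>\<^sup>*\<^bsub>G\<^esub> v" if uv: "u \<in> verts G" "v \<in> verts G" for u v
  proof -
    obtain p q where "awalk b p u" "awalk b q v" using assms(2) uv by metis
    then have "awalk u (rwalk p @ q) v" by (intro awalk_appendI awalk_rwalk)
    then show ?thesis by (rule reachable_awalkI)
  qed
  then have "strongly_connected (with_proj (mk_symmetric G))"
    using assms(1) unfolding strongly_connected_def
    by (auto intro: reachable_mk_symmetricI)
  then show ?thesis by (simp add: connected_def)
qed

locale two_generator_group = simplicial_tree +
  fixes g h :: "'a \<Rightarrow> 'a"
  assumes g_aut: "g \<in> carrier (aut_group X)"
    and h_aut: "h \<in> carrier (aut_group X)"
    and no_inversions: "\<gamma> \<in> generate (aut_group X) {g, h} \<Longrightarrow> \<not> inverts_edge X \<gamma>"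
begin

abbreviation (input) H :: "('a \<Rightarrow> 'a) set" where
  "H \<equiv> generate (aut_group X) {g, h}"

abbreviation (input) \<Gamma> :: "('a \<Rightarrow> 'a) monoid" where
  "\<Gamma> \<equiv> generated_group X {g, h}"

lemma carrier_\<Gamma> [simp]: "carrier \<Gamma> = H"
  by (simp add: generated_group_def)

lemma H_aut: "\<gamma> \<in> H \<Longrightarrow> \<gamma> \<in> Aut"
  using group.generate_in_carrier[OF group_aut, of "{g, h}"] g_aut h_aut by blast

lemma H_one: "\<one>\<^bsub>aut_group X\<^esub> \<in> H"
  by (rule generate.one)

lemma H_mult: "\<gamma> \<in> H \<Longrightarrow> \<delta> \<in> H \<Longrightarrow> \<gamma> \<otimes>\<^bsub>aut_group X\<^esub> \<delta> \<in> H"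
  by (rule generate.eng)

lemma H_inv: "\<gamma> \<in> H \<Longrightarrow> inv\<^bsub>aut_group X\<^esub> \<gamma> \<in> H"
  using group.generate_m_inv_closed[OF group_aut, of "{g, h}"] g_aut h_aut by blast

lemma H_gens: "g \<in> H" "h \<in> H"
  by (auto intro: generate.incl)

lemma map_prod_mult:
  assumes "\<gamma> \<in> H" "\<delta> \<in> H" "a \<in> parcs X"
  shows "map_prod (\<gamma> \<otimes>\<^bsub>aut_group X\<^esub> \<delta>) (\<gamma> \<otimes>\<^bsub>aut_group X\<^esub> \<delta>) a = map_prod \<gamma> \<gamma> (map_prod \<delta> \<delta> a)"
  using act_mult[OF H_aut[OF assms(1)] H_aut[OF assms(2)], of "[a]"] assms(3) by simp

lemma map_prod_inv:
  assumes "\<gamma> \<in> H" "a \<in> parcs X"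
  shows "map_prod (inv\<^bsub>aut_group X\<^esub> \<gamma>) (inv\<^bsub>aut_group X\<^esub> \<gamma>) (map_prod \<gamma> \<gamma> a) = a"
  using act_inv(1)[OF H_aut[OF assms(1)], of "[a]"] assms(2) by simp

lemma map_prod_one: "a \<in> parcs X \<Longrightarrow> map_prod \<one>\<^bsub>aut_group X\<^esub> \<one>\<^bsub>aut_group X\<^esub> a = a"
  using arc_ends[of a] aut_one by (cases a) simp

definition vert_orbit :: "'a \<Rightarrow> 'a set" where
  "vert_orbit x = {\<gamma> x |\<gamma>. \<gamma> \<in> H}"

definition arc_orbit :: "'a \<times> 'a \<Rightarrow> ('a \<times> 'a) set" where
  "arc_orbit a = {map_prod \<gamma> \<gamma> a |\<gamma>. \<gamma> \<in> H}"

lemma vert_orbit_self: "x \<in> pverts X \<Longrightarrow> x \<in> vert_orbit x"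
  unfolding vert_orbit_def by (rule CollectI, rule exI[of _ "\<one>\<^bsub>aut_group X\<^esub>"]) (simp add: H_one aut_one)

lemma arc_orbit_self: "a \<in> parcs X \<Longrightarrow> a \<in> arc_orbit a"
  unfolding arc_orbit_def
  by (rule CollectI, rule exI[of _ "\<one>\<^bsub>aut_group X\<^esub>"]) (simp add: H_one map_prod_one)

lemma vert_orbit_translate:
  assumes "\<gamma> \<in> H" "x \<in> pverts X"
  shows "vert_orbit (\<gamma> x) = vert_orbit x"
proof (intro equalityI subsetI)
  fix y assume "y \<in> vert_orbit (\<gamma> x)"
  then obtain \<delta> where "\<delta> \<in> H" "y = \<delta> (\<gamma> x)" by (auto simp: vert_orbit_def)
  then have "y = (\<delta> \<otimes>\<^bsub>aut_group X\<^esub> \<gamma>) x" "\<delta> \<otimes>\<^bsub>aut_group X\<^esub> \<gamma> \<in> H"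
    using assms aut_mult[OF H_aut H_aut] H_mult by auto
  then show "y \<in> vert_orbit x" by (auto simp: vert_orbit_def)
next
  fix y assume "y \<in> vert_orbit x"
  then obtain \<delta> where d: "\<delta> \<in> H" "y = \<delta> x" by (auto simp: vert_orbit_def)
  let ?k = "inv\<^bsub>aut_group X\<^esub> \<gamma>"
  have "(\<delta> \<otimes>\<^bsub>aut_group X\<^esub> ?k) (\<gamma> x) = y"
    using aut_mult[OF H_aut[OF d(1)] H_aut[OF H_inv[OF assms(1)]]] d assms
      aut_inv(2)[OF H_aut[OF assms(1)]] aut_vert[OF H_aut[OF assms(1)]] by simp
  then show "y \<in> vert_orbit (\<gamma> x)"
    using H_mult[OF d(1) H_inv[OF assms(1)]] unfolding vert_orbit_def by blast
qed

lemma arc_orbit_translate: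
  assumes "\<gamma> \<in> H" "a \<in> parcs X"
  shows "arc_orbit (map_prod \<gamma> \<gamma> a) = arc_orbit a"
proof (intro equalityI subsetI)
  fix y assume "y \<in> arc_orbit (map_prod \<gamma> \<gamma> a)"
  then obtain \<delta> where "\<delta> \<in> H" "y = map_prod \<delta> \<delta> (map_prod \<gamma> \<gamma> a)" unfolding arc_orbit_def by blast
  then show "y \<in> arc_orbit a"
    using assms H_mult map_prod_mult[symmetric] unfolding arc_orbit_def by blast
next
  fix y assume "y \<in> arc_orbit a"
  then obtain \<delta> where d: "\<delta> \<in> H" "y = map_prod \<delta> \<delta> a" unfolding arc_orbit_def by blast
  let ?k = "inv\<^bsub>aut_group X\<^esub> \<gamma>"
  have "map_prod (\<delta> \<otimes>\<^bsub>aut_group X\<^esub> ?k) (\<delta> \<otimes>\<^bsub>aut_group X\<^esub> ?k) (map_prod \<gamma> \<gamma> a) = y"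
    using map_prod_mult[OF d(1) H_inv[OF assms(1)] aut_arc[OF H_aut[OF assms(1)] assms(2)]]
      map_prod_inv[OF assms] d by simp
  then show "y \<in> arc_orbit (map_prod \<gamma> \<gamma> a)"
    using H_mult[OF d(1) H_inv[OF assms(1)]] unfolding arc_orbit_def by blast
qed

lemma vert_orbit_eqD:
  assumes "vert_orbit x = vert_orbit y" "y \<in> pverts X"
  obtains \<gamma> where "\<gamma> \<in> H" "y = \<gamma> x"
  using vert_orbit_self[OF assms(2)] assms(1) unfolding vert_orbit_def by blast

lemma arc_orbit_eqD:
  assumes "arc_orbit a = arc_orbit c" "c \<in> parcs X"
  obtains \<gamma> where "\<gamma> \<in> H" "c = map_prod \<gamma> \<gamma> a"
  using arc_orbit_self[OF assms(2)] assms(1) unfolding arc_orbit_def by blast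

lemma fst_arc_orbit: "fst ` arc_orbit a = vert_orbit (fst a)" and snd_arc_orbit: "snd ` arc_orbit a = vert_orbit (snd a)"
  by (force simp: arc_orbit_def vert_orbit_def)+

lemma converse_arc_orbit: "(arc_orbit a)\<inverse> = arc_orbit (prod.swap a)"
  by (cases a) (force simp: arc_orbit_def)

lemma arc_orbit_swap_neq:
  assumes "a \<in> parcs X"
  shows "arc_orbit (prod.swap a) \<noteq> arc_orbit a"
proof
  assume eq: "arc_orbit (prod.swap a) = arc_orbit a"
  obtain \<gamma> where \<gamma>: "\<gamma> \<in> H" "prod.swap a = map_prod \<gamma> \<gamma> a"
    by (rule arc_orbit_eqD[OF eq[symmetric] swap_in_parcs[OF assms]])
  have "\<gamma> (fst a) = snd a" "\<gamma> (snd a) = fst a"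
    using arg_cong[OF \<gamma>(2), of fst] arg_cong[OF \<gamma>(2), of snd] by (metis fst_map_prod fst_swap, metis snd_map_prod snd_swap)
  then have "inverts_edge X \<gamma>"
    using assms unfolding inverts_edge_def by (intro bexI[of _ a]) (auto simp: case_prod_beta)
  with no_inversions[OF \<gamma>(1)] show False by blast
qed

end

section \<open>The subgraph swept by a lifted tadpole\<close>

text \<open>
  The union of \<open>p\<close> and \<open>q\<close> is a lift of a tadpole to the tree. Since \<open>h\<close> moves \<open>w\<close> to the end of
  \<open>p\<close> and \<open>g\<close> fixes the end of \<open>q\<close>, the union meets its images under both generators, which
  makes the union of all translates connected.
\<close>
locale fundamental_tadpole = two_generator_group +
  fixes w v :: 'a and p q :: "('a \<times> 'a) list"
  assumes p_walk: "awalk w p (h w)" and p_nonempty: "p \<noteq> []"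
    and q_walk: "awalk w q v" and v_fixed: "g v = v"
begin

definition sweep_arcs :: "('a \<times> 'a) set" where
  "sweep_arcs = {map_prod \<gamma> \<gamma> a |\<gamma> a. \<gamma> \<in> H \<and> (a \<in> set (p @ q) \<or> prod.swap a \<in> set (p @ q))}"

text \<open>
  Every vertex of the tadpole is the tail of an arc, since its circuit is not empty; so the tails of
  the swept arcs are all swept vertices.
\<close>
definition sweep :: "'a pair_pre_digraph" where
  "sweep = \<lparr>pverts = fst ` sweep_arcs, parcs = sweep_arcs\<rparr>"

abbreviation (input) Y where "Y \<equiv> quotient_graph sweep \<Gamma>"
abbreviation (input) r where "r \<equiv> quotient_rev sweep \<Gamma>"

lemma pq_arcs: "set (p @ q) \<subseteq> parcs X"
  using walk_arcs[OF p_walk] walk_arcs[OF q_walk] by simp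

lemma w_vert: "w \<in> pverts X"
  using p_walk awalk_hd_in_verts by fastforce

lemma sweep_arcsI: "\<gamma> \<in> H \<Longrightarrow> c \<in> set (p @ q) \<or> prod.swap c \<in> set (p @ q) \<Longrightarrow> map_prod \<gamma> \<gamma> c \<in> sweep_arcs"
  unfolding sweep_arcs_def by blast

lemma sweep_arcsE:
  assumes "a \<in> sweep_arcs"
  obtains \<gamma> c where "\<gamma> \<in> H" "a = map_prod \<gamma> \<gamma> c" "c \<in> parcs X"
    "c \<in> set (p @ q) \<or> prod.swap c \<in> set (p @ q)"
proof -
  obtain \<gamma> c where c: "\<gamma> \<in> H" "a = map_prod \<gamma> \<gamma> c"
    "c \<in> set (p @ q) \<or> prod.swap c \<in> set (p @ q)"
    using assms unfolding sweep_arcs_def mem_Collect_eq by (elim exE conjE)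
  moreover have "c \<in> parcs X"
    using c(3)
  proof
    assume "prod.swap c \<in> set (p @ q)"
    then have "prod.swap c \<in> parcs X" using pq_arcs by blast
    from swap_in_parcs[OF this] show ?thesis by simp
  qed (use pq_arcs in blast)
  ultimately show ?thesis using that by blast
qed

lemma sweep_arcs_in_X: "a \<in> sweep_arcs \<Longrightarrow> a \<in> parcs X"
  by (elim sweep_arcsE) (simp add: aut_arc[OF H_aut])

lemma sweep_arcs_swap: "a \<in> sweep_arcs \<Longrightarrow> prod.swap a \<in> sweep_arcs"
proof (elim sweep_arcsE)
  fix \<gamma> c assume "\<gamma> \<in> H" "a = map_prod \<gamma> \<gamma> c" "c \<in> set (p @ q) \<or> prod.swap c \<in> set (p @ q)"
  then have "prod.swap a = map_prod \<gamma> \<gamma> (prod.swap c)"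
    "prod.swap c \<in> set (p @ q) \<or> prod.swap (prod.swap c) \<in> set (p @ q)"
    by (auto simp: swap_map_prod)
  with \<open>\<gamma> \<in> H\<close> show ?thesis by (metis sweep_arcsI)
qed

lemma sweep_arcs_translate: 
  assumes "\<delta> \<in> H" "a \<in> sweep_arcs" shows "map_prod \<delta> \<delta> a \<in> sweep_arcs"
  using assms(2)
proof (rule sweep_arcsE)
  fix \<gamma> c assume c: "\<gamma> \<in> H" "a = map_prod \<gamma> \<gamma> c" "c \<in> parcs X"
    "c \<in> set (p @ q) \<or> prod.swap c \<in> set (p @ q)"
  then show ?thesis
    using map_prod_mult[OF assms(1) c(1,3)] sweep_arcsI[OF H_mult[OF assms(1) c(1)] c(4)] by simp
qed

lemma pq_sweep: "a \<in> set (p @ q) \<Longrightarrow> a \<in> sweep_arcs"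
  using sweep_arcsI[OF H_one, of a] map_prod_one[of a] pq_arcs by auto

lemma sweep_verts_in_X: "x \<in> fst ` sweep_arcs \<Longrightarrow> x \<in> pverts X"
  using sweep_arcs_in_X arc_ends by blast

lemma snd_sweep: "a \<in> sweep_arcs \<Longrightarrow> snd a \<in> fst ` sweep_arcs"
  using sweep_arcs_swap[of a] by (metis fst_swap image_eqI)

lemma sweep_verts_translate: "\<gamma> \<in> H \<Longrightarrow> x \<in> fst ` sweep_arcs \<Longrightarrow> \<gamma> x \<in> fst ` sweep_arcs"
proof (elim imageE)
  fix a assume "\<gamma> \<in> H" "x = fst a" "a \<in> sweep_arcs"
  then have "\<gamma> x = fst (map_prod \<gamma> \<gamma> a)" "map_prod \<gamma> \<gamma> a \<in> sweep_arcs"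
    using sweep_arcs_translate by simp_all
  then show ?thesis by (rule image_eqI)
qed

lemma verts_Y: "verts Y = vert_orbit ` (fst ` sweep_arcs)"
  by (auto simp: quotient_graph_def sweep_def orbits_def orbit_def vert_orbit_def)

lemma arcs_Y: "arcs Y = arc_orbit ` sweep_arcs"
proof -
  have "arcs Y = orbits \<Gamma> sweep_arcs (\<lambda>\<gamma>. map_prod \<gamma> \<gamma>)"
    by (simp add: quotient_graph_def sweep_def)
  also have "\<dots> = arc_orbit ` sweep_arcs"
    unfolding orbits_def orbit_def arc_orbit_def carrier_\<Gamma> by blast
  finally show ?thesis .
qed

lemma tail_Y: "tail Y (arc_orbit a) = vert_orbit (fst a)" and head_Y: "head Y (arc_orbit a) = vert_orbit (snd a)"
  by (simp_all add: quotient_graph_def fst_arc_orbit snd_arc_orbit)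

lemma r_arc_orbit: "a \<in> sweep_arcs \<Longrightarrow> r (arc_orbit a) = arc_orbit (prod.swap a)"
  unfolding quotient_rev_def arcs_Y by (simp add: converse_arc_orbit)

text \<open>
  The reversal of arcs of the quotient has no fixed point because the group inverts no edge.
\<close>
lemma bidirected_Y: "bidirected_digraph Y r"
proof
  fix e assume "e \<in> arcs Y"
  then obtain a where a: "a \<in> sweep_arcs" "e = arc_orbit a" by (auto simp: arcs_Y)
  show "tail Y e \<in> verts Y" "head Y e \<in> verts Y"
    using a snd_sweep by (auto simp: tail_Y head_Y verts_Y)
  show "r (r e) = e"
    using a sweep_arcs_swap by (simp add: r_arc_orbit)
  show "tail Y (r e) = head Y e"
    using a by (simp add: r_arc_orbit tail_Y head_Y)
next
  fix e show "e \<in> arcs Y \<longleftrightarrow> r e \<noteq> e"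
  proof
    assume "e \<in> arcs Y"
    then obtain a where a: "a \<in> sweep_arcs" "e = arc_orbit a" by (auto simp: arcs_Y)
    then show "r e \<noteq> e" using arc_orbit_swap_neq[OF sweep_arcs_in_X] by (simp add: r_arc_orbit)
  qed (auto simp: quotient_rev_def)
qed

end

sublocale fundamental_tadpole \<subseteq> Y: serre_graph Y r
  by (rule bidirected_digraph.serre_graph[OF bidirected_Y])

context fundamental_tadpole
begin

lemma project_walk:
  "awalk x es y \<Longrightarrow> set es \<subseteq> sweep_arcs \<Longrightarrow> x \<in> fst ` sweep_arcs \<Longrightarrow> Y.awalk (vert_orbit x) (map arc_orbit es) (vert_orbit y)"
proof (induction es arbitrary: x)
  case Nil
  then show ?case by (auto simp: awalk_Nil_iff Y.awalk_Nil_iff verts_Y)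
next
  case (Cons a es)
  then show ?case
    using snd_sweep[of a] by (auto simp: awalk_Cons_iff Y.awalk_Cons_iff arcs_Y tail_Y head_Y)
qed

text \<open>
  Consecutive arcs of a walk in the quotient can be translated one after the other so as to start
  where the preceding one ends.
\<close>
lemma lift_walk:
  "Y.awalk (vert_orbit x) P V \<Longrightarrow> x \<in> fst ` sweep_arcs \<Longrightarrow>
     \<exists>es y. awalk x es y \<and> set es \<subseteq> sweep_arcs \<and> map arc_orbit es = P \<and> V = vert_orbit y"
proof (induction P arbitrary: x)
  case Nil
  then show ?case
    using sweep_verts_in_X by (intro exI[of _ "[]"] exI[of _ x]) (auto simp: awalk_Nil_iff Y.awalk_Nil_iff)
next
  case (Cons e P)
  then obtain a where a: "a \<in> sweep_arcs" "e = arc_orbit a" "vert_orbit (fst a) = vert_orbit x"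
    and P: "Y.awalk (vert_orbit (snd a)) P V"
    by (auto simp: Y.awalk_Cons_iff arcs_Y tail_Y head_Y)
  obtain \<gamma> where \<gamma>: "\<gamma> \<in> H" "x = \<gamma> (fst a)"
    using vert_orbit_eqD[OF a(3) sweep_verts_in_X[OF Cons.prems(2)]] by blast
  let ?a = "map_prod \<gamma> \<gamma> a"
  have "vert_orbit (snd ?a) = vert_orbit (snd a)"
    using vert_orbit_translate[OF \<gamma>(1)] arc_ends(2)[OF sweep_arcs_in_X[OF a(1)]] by simp
  then obtain es y where es: "awalk (snd ?a) es y" "set es \<subseteq> sweep_arcs" "map arc_orbit es = P" "V = vert_orbit y"
    using Cons.IH[of "snd ?a"] P snd_sweep[OF sweep_arcs_translate[OF \<gamma>(1) a(1)]] by auto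
  have "awalk x (?a # es) y"
    using es(1) \<gamma> sweep_arcs_in_X[OF sweep_arcs_translate[OF \<gamma>(1) a(1)]] by (simp add: awalk_Cons_iff)
  moreover have "map arc_orbit (?a # es) = e # P"
    using a es(3) arc_orbit_translate[OF \<gamma>(1) sweep_arcs_in_X[OF a(1)]] by simp
  ultimately show ?case
    using es sweep_arcs_translate[OF \<gamma>(1) a(1)] by (metis insert_subset list.simps(15))
qed

lemma project_rwalk: "set es \<subseteq> sweep_arcs \<Longrightarrow> map arc_orbit (rwalk es) = Y.rwalk (map arc_orbit es)"
  by (induction es) (auto simp: r_arc_orbit)

lemma project_act:
  "\<gamma> \<in> H \<Longrightarrow> set es \<subseteq> sweep_arcs \<Longrightarrow> map arc_orbit (act \<gamma> es) = map arc_orbit es"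
  by (auto simp: act_def arc_orbit_translate sweep_arcs_in_X subset_iff simp del: map_prod_simp)

lemma project_cancels:
  "(cancel prod.swap)\<^sup>*\<^sup>* es es' \<Longrightarrow> set es \<subseteq> sweep_arcs \<Longrightarrow> (cancel r)\<^sup>*\<^sup>* (map arc_orbit es) (map arc_orbit es')"
proof (induction rule: rtranclp_induct)
  case (step y z)
  have "set y \<subseteq> sweep_arcs" using cancels_subset[OF step(1)] step by blast
  from step(2) this have "cancel r (map arc_orbit y) (map arc_orbit z)"
  proof cases
    case (1 xs a ys)
    with \<open>set y \<subseteq> sweep_arcs\<close> show ?thesis
      using cancel.intros[of r "map arc_orbit xs" "arc_orbit a" "map arc_orbit ys"] by (simp add: r_arc_orbit)
  qed
  with step show ?case by (meson rtranclp.rtrancl_into_rtrancl)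
qed simp

lemma act_sweep: "\<gamma> \<in> H \<Longrightarrow> set es \<subseteq> sweep_arcs \<Longrightarrow> set (act \<gamma> es) \<subseteq> sweep_arcs"
  using sweep_arcs_translate by auto

lemma rwalk_sweep: "set es \<subseteq> sweep_arcs \<Longrightarrow> set (rwalk es) \<subseteq> sweep_arcs"
  using sweep_arcs_swap by (auto simp: set_rwalk)

abbreviation (input) tp where "tp \<equiv> tadpole (length p) (length q)"

text \<open>
  The numbering agrees with that of the tadpole graph, whose edges are first those of the circuit and
  then those of the path. The junction \<open>0\<close> lifts to \<open>w\<close>; the circuit closes up only in the quotient,
  where \<open>w\<close> and \<open>h w\<close> have the same orbit.
\<close>
definition arc_lift :: "nat \<times> bool \<Rightarrow> 'a \<times> 'a" where
  "arc_lift a = (if snd a then (p @ q) ! fst a else prod.swap ((p @ q) ! fst a))"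

definition vert_lift :: "nat \<Rightarrow> 'a" where
  "vert_lift i = (if i < length p then fst (p ! i) else snd (q ! (i - length p)))"

abbreviation (input) fe where "fe a \<equiv> arc_orbit (arc_lift a)"
abbreviation (input) fv where "fv i \<equiv> vert_orbit (vert_lift i)"

lemma tp_simps:
  "verts tp = {..<length p + length q}" "arcs tp = {..<length p + length q} \<times> UNIV"
  "tail tp (i, True) = tadpole_from (length p) i" "tail tp (i, False) = tadpole_to (length p) i"
  "head tp (i, True) = tadpole_to (length p) i" "head tp (i, False) = tadpole_from (length p) i"
  by (simp_all add: tadpole_def)

lemma nth_pq_sweep: "i < length p + length q \<Longrightarrow> (p @ q) ! i \<in> sweep_arcs"
  by (intro pq_sweep nth_mem) simp

lemma arc_lift_sweep: "a \<in> arcs tp \<Longrightarrow> arc_lift a \<in> sweep_arcs"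
  using nth_pq_sweep[of "fst a"] sweep_arcs_swap[of "(p @ q) ! fst a"] by (cases a) (simp add: tp_simps arc_lift_def)

lemma sweep_arc_lift: "e \<in> sweep_arcs \<Longrightarrow> \<exists>a\<in>arcs tp. fe a = arc_orbit e"
proof (elim sweep_arcsE)
  fix \<gamma> c assume c: "\<gamma> \<in> H" "e = map_prod \<gamma> \<gamma> c" "c \<in> parcs X"
    "c \<in> set (p @ q) \<or> prod.swap c \<in> set (p @ q)"
  from c(4) have "\<exists>a\<in>arcs tp. arc_lift a = c"
  proof
    assume "c \<in> set (p @ q)"
    then obtain i where "i < length (p @ q)" "(p @ q) ! i = c" by (metis in_set_conv_nth)
    then show ?thesis by (intro bexI[of _ "(i, True)"]) (auto simp: arc_lift_def tp_simps)
  next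
    assume "prod.swap c \<in> set (p @ q)"
    then obtain i where "i < length (p @ q)" "(p @ q) ! i = prod.swap c" by (metis in_set_conv_nth)
    then show ?thesis by (intro bexI[of _ "(i, False)"]) (auto simp: arc_lift_def tp_simps)
  qed
  with c arc_orbit_translate show ?thesis by metis
qed

lemma walk_nth_ends:
  assumes "awalk x s y"
  shows "s \<noteq> [] \<Longrightarrow> fst (s ! 0) = x" "Suc i < length s \<Longrightarrow> snd (s ! i) = fst (s ! Suc i)"
    "s \<noteq> [] \<Longrightarrow> snd (s ! (length s - 1)) = y"
proof -
  show "s \<noteq> [] \<Longrightarrow> fst (s ! 0) = x"
    using assms by (cases s) (auto simp: awalk_Cons_iff)
  show "snd (s ! i) = fst (s ! Suc i)" if i: "Suc i < length s"
  proof -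
    have "s = take i s @ s ! i # s ! Suc i # drop (Suc (Suc i)) s"
      using i by (metis Cons_nth_drop_Suc Suc_lessD append_take_drop_id)
    then show ?thesis
      using assms by (metis awalk_append_split awalk_Cons_iff with_proj_simps(4,5))
  qed
  show "snd (s ! (length s - 1)) = y" if ne: "s \<noteq> []"
  proof -
    obtain t a where "s = t @ [a]" using ne by (cases s rule: rev_cases) auto
    then show ?thesis
      using assms by (auto simp: awalk_append_split awalk_Cons_iff awalk_Nil_iff simp del: awalk_append_iff)
  qed
qed

lemma arc_lift_ends:
  assumes "i < length p + length q"
  shows "vert_orbit (fst ((p @ q) ! i)) = fv (tadpole_from (length p) i)"
    and "vert_orbit (snd ((p @ q) ! i)) = fv (tadpole_to (length p) i)"
proof -
  have w: "fst (p ! 0) = w" "q \<noteq> [] \<Longrightarrow> fst (q ! 0) = w"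
    using walk_nth_ends(1)[OF p_walk p_nonempty] walk_nth_ends(1)[OF q_walk] by auto
  have lp: "length p > 0" using p_nonempty by simp
  have q_step: "snd (q ! n) = fst (q ! Suc n)" if "Suc n < length q" for n
    using walk_nth_ends(2)[OF q_walk that] .
  consider "i < length p" | "i = length p" | n where "i = length p + Suc n"
    by (metis add_Suc_right less_imp_Suc_add linorder_neqE_nat)
  then show "vert_orbit (fst ((p @ q) ! i)) = fv (tadpole_from (length p) i)"
  proof cases
    case 2
    then have "q \<noteq> []" using assms by auto
    with 2 show ?thesis using w lp by (simp add: tadpole_from_def vert_lift_def nth_append)
  next
    case (3 n)
    then show ?thesis using q_step[of n] assms lp
      by (simp add: tadpole_from_def vert_lift_def nth_append)
  qed (simp add: tadpole_from_def vert_lift_def nth_append)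
  consider "Suc i < length p" | "i = length p - 1" | "i \<ge> length p" by linarith
  then show "vert_orbit (snd ((p @ q) ! i)) = fv (tadpole_to (length p) i)"
  proof cases
    case 1
    then show ?thesis using walk_nth_ends(2)[OF p_walk 1]
      by (simp add: tadpole_to_def vert_lift_def nth_append)
  next
    case 2
    then have "snd ((p @ q) ! i) = h w" "tadpole_to (length p) i = 0"
      using walk_nth_ends(3)[OF p_walk p_nonempty] lp by (auto simp: nth_append tadpole_to_def)
    then show ?thesis
      using w lp vert_orbit_translate[OF H_gens(2) w_vert] by (simp add: vert_lift_def)
  next
    case 3
    then show ?thesis by (simp add: tadpole_to_def vert_lift_def nth_append)
  qed
qed

lemma tp_arc_ends:
  assumes "a \<in> arcs tp"
  shows "vert_orbit (fst (arc_lift a)) = fv (tail tp a)" "vert_orbit (snd (arc_lift a)) = fv (head tp a)"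
proof -
  obtain i b where a: "a = (i, b)" "i < length p + length q"
    using assms by (cases a) (auto simp: tp_simps)
  show "vert_orbit (fst (arc_lift a)) = fv (tail tp a)" "vert_orbit (snd (arc_lift a)) = fv (head tp a)"
    using arc_lift_ends[OF a(2)] a(1) by (cases b; simp add: arc_lift_def tp_simps)+
qed

lemma tp_rev:
  assumes "a \<in> arcs tp"
  shows "(fst a, \<not> snd a) \<in> arcs tp" "arc_lift (fst a, \<not> snd a) = prod.swap (arc_lift a)"
    "tail tp (fst a, \<not> snd a) = head tp a" "head tp (fst a, \<not> snd a) = tail tp a"
  using assms by (auto simp: tp_simps arc_lift_def tadpole_def)

section \<open>Forced identifications of vertices\<close>

text \<open>
  The equivalence relation on the vertices of the tadpole that is forced by the identification of
  its arcs in the quotient.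
\<close>
definition identified :: "nat \<Rightarrow> nat \<Rightarrow> bool" where
  "identified = equivclp (\<lambda>x y. \<exists>a\<in>arcs tp. \<exists>b\<in>arcs tp. fe a = fe b \<and> x = tail tp a \<and> y = tail tp b)"

lemma identified_refl [simp]: "identified i i"
  and identified_sym: "identified i j \<Longrightarrow> identified j i"
  and identified_trans: "identified i j \<Longrightarrow> identified j k \<Longrightarrow> identified i k"
  unfolding identified_def by (auto intro: equivclp_sym equivclp_trans)

text \<open>
  The choice of the arc matters only up to forced identifications, and the label of an arc of the
  swept tree depends only on its orbit.
\<close>
definition label :: "'a \<times> 'a \<Rightarrow> nat" where
  "label e = tail tp (SOME a. a \<in> arcs tp \<and> fe a = arc_orbit e)"

lemma label_cong: "arc_orbit e = arc_orbit e' \<Longrightarrow> label e = label e'"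
  by (simp add: label_def)

lemma identified_label:
  assumes "a \<in> arcs tp" "fe a = arc_orbit e"
  shows "identified (tail tp a) (label e)" "identified (label (prod.swap e)) (head tp a)"
proof -
  have key: "identified (tail tp a) (label e)" if "a \<in> arcs tp" "fe a = arc_orbit e" for a e
  proof -
    have "\<exists>b. b \<in> arcs tp \<and> fe b = arc_orbit e" using that by blast
    from someI_ex[OF this] show ?thesis
      unfolding identified_def label_def using that by (intro r_into_equivclp) auto
  qed
  show "identified (tail tp a) (label e)" using key assms by blast
  have "arc_orbit (prod.swap (arc_lift a)) = arc_orbit (prod.swap e)"
    using assms(2) converse_arc_orbit by metis
  then show "identified (label (prod.swap e)) (head tp a)"
    using key[of "(fst a, \<not> snd a)" "prod.swap e"] tp_rev[OF assms(1)] identified_sym by metis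
qed

text \<open>
  A walk from \<open>i\<close> to \<open>j\<close> in the quotient of the tadpole by the forced identifications, expressed by
  a walk in the tree. The head of an arc is labelled by the tail of its reverse.
\<close>
primrec coherent :: "nat \<Rightarrow> ('a \<times> 'a) list \<Rightarrow> nat \<Rightarrow> bool" where
  "coherent i [] j \<longleftrightarrow> identified i j"
| "coherent i (e # es) j \<longleftrightarrow> identified i (label e) \<and> coherent (label (prod.swap e)) es j"

lemma coherent_left: "identified i k \<Longrightarrow> coherent k es j \<Longrightarrow> coherent i es j"
  by (cases es) (auto intro: identified_trans)

lemma coherent_append:
  "coherent i (xs @ ys) j \<longleftrightarrow> (\<exists>k. coherent i xs k \<and> coherent k ys j)"
proof (induction xs arbitrary: i)
  case Nil
  then show ?case by (auto intro: coherent_left identified_refl)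
qed auto

text \<open>
  The label at the end of a backtrack \<open>[a, prod.swap a]\<close> is that at its beginning, so the remaining
  parts still fit together.
\<close>
lemma coherent_cancel: "cancel prod.swap es es' \<Longrightarrow> coherent i es j \<Longrightarrow> coherent i es' j"
proof (cases rule: cancel.cases, assumption)
  fix xs a ys assume "coherent i es j" "es = xs @ [a, prod.swap a] @ ys" "es' = xs @ ys"
  then show ?thesis by (auto simp: coherent_append intro: coherent_left)
qed

lemma coherent_cancels:
  "(cancel prod.swap)\<^sup>*\<^sup>* es es' \<Longrightarrow> coherent i es j \<Longrightarrow> coherent i es' j"
  by (induction rule: rtranclp_induct) (auto intro: coherent_cancel)

lemma coherent_rwalk: "coherent i es j \<Longrightarrow> coherent j (rwalk es) i"
proof (induction es arbitrary: i)
  case Nil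
  then show ?case by (auto intro: identified_sym)
next
  case (Cons a es)
  then show ?case
    by (auto simp: coherent_append intro!: exI[of _ "label (prod.swap a)"] intro: identified_sym)
qed

lemma coherent_act: "\<gamma> \<in> H \<Longrightarrow> set es \<subseteq> sweep_arcs \<Longrightarrow> coherent i es j \<Longrightarrow> coherent i (act \<gamma> es) j"
proof (induction es arbitrary: i)
  case (Cons a es)
  have a: "a \<in> sweep_arcs" using Cons.prems by simp
  have "label (map_prod \<gamma> \<gamma> a) = label a"
    by (rule label_cong[OF arc_orbit_translate[OF Cons.prems(1) sweep_arcs_in_X[OF a]]])
  moreover have "label (prod.swap (map_prod \<gamma> \<gamma> a)) = label (prod.swap a)"
    unfolding swap_map_prod
    by (rule label_cong[OF arc_orbit_translate[OF Cons.prems(1) sweep_arcs_in_X[OF sweep_arcs_swap[OF a]]]])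
  ultimately have *: ?case if "coherent (label (prod.swap a)) (act \<gamma> es) j"
    using Cons.prems(3) that by simp
  show ?case
    using Cons by (intro *) simp
qed simp

lemma coherent_take:
  assumes "\<And>n. n < length s \<Longrightarrow> lab n \<in> arcs tp \<and> arc_lift (lab n) = s ! n \<and>
             tail tp (lab n) = L n \<and> head tp (lab n) = L (Suc n)"
    and "n \<le> length s"
  shows "coherent (L 0) (take n s) (L n)"
  using assms(2)
proof (induction n)
  case (Suc n)
  have "identified (L n) (label (s ! n))" "identified (label (prod.swap (s ! n))) (L (Suc n))"
    using identified_label[of "lab n" "s ! n"] assms(1)[of n] Suc.prems by auto
  with Suc show ?case
    by (auto simp: take_Suc_conv_app_nth coherent_append)
qed simp

lemma coherent_take_p: "n \<le> length p \<Longrightarrow> coherent 0 (take n p) (n mod length p)"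
  using coherent_take[of p "\<lambda>n. (n, True)" "\<lambda>n. n mod length p" n]
  by (auto simp: tp_simps arc_lift_def nth_append tadpole_from_def tadpole_to_def)

lemma coherent_take_q:
  "n \<le> length q \<Longrightarrow> coherent 0 (take n q) (if n = 0 then 0 else length p + n - 1)"
  using coherent_take[of q "\<lambda>n. (length p + n, True)" "\<lambda>n. if n = 0 then 0 else length p + n - 1" n]
  by (auto simp: tp_simps arc_lift_def nth_append tadpole_from_def tadpole_to_def)

lemma take_walk:
  assumes "awalk x s y" "n < length s"
  shows "awalk x (take n s) (fst (s ! n))" "awalk x (take (Suc n) s) (snd (s ! n))"
proof -
  have "s = take n s @ s ! n # drop (Suc n) s"
    using assms(2) by (rule id_take_nth_drop)
  then have *: "awalk x (take n s) (fst (s ! n))" "s ! n \<in> parcs X"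
    using assms(1) by (metis awalk_append_split awalk_Cons_iff with_proj_simps)+
  then show "awalk x (take n s) (fst (s ! n))" by simp
  show "awalk x (take (Suc n) s) (snd (s ! n))"
    using awalk_appendI[OF *(1)] arc_implies_awalk[of "s ! n"] *(2) assms(2)
    by (simp add: take_Suc_conv_app_nth del: awalk_append_iff)
qed

lemma coherent_walk_to_lift:
  assumes "i < length p + length q"
  shows "\<exists>es. awalk w es (vert_lift i) \<and> set es \<subseteq> sweep_arcs \<and> coherent 0 es i"
proof (cases "i < length p")
  case True
  have "set (take i p) \<subseteq> sweep_arcs" using pq_sweep by (auto dest: in_set_takeD)
  with True show ?thesis
    using take_walk(1)[OF p_walk True] coherent_take_p[of i]
    by (intro exI[of _ "take i p"]) (simp add: vert_lift_def)
next
  case False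
  define n where "n = i - length p"
  have n: "n < length q" "i = length p + n" using False assms by (auto simp: n_def)
  have "set (take (Suc n) q) \<subseteq> sweep_arcs" using pq_sweep by (auto dest: in_set_takeD)
  with n show ?thesis
    using take_walk(2)[OF q_walk n(1)] coherent_take_q[of "Suc n"]
    by (intro exI[of _ "take (Suc n) q"]) (simp add: vert_lift_def)
qed

section \<open>The class of a group element in the quotient\<close>

abbreviation (input) \<beta> where "\<beta> \<equiv> map arc_orbit p"

lemma w_sweep: "w \<in> fst ` sweep_arcs"
proof -
  have "p ! 0 \<in> sweep_arcs" using p_nonempty by (intro pq_sweep) auto
  then show ?thesis using walk_nth_ends(1)[OF p_walk p_nonempty] by force
qed

lemma \<beta>_loop: "Y.awalk (vert_orbit w) \<beta> (vert_orbit w)"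
proof -
  have "set p \<subseteq> sweep_arcs" using pq_sweep by auto
  from project_walk[OF p_walk this w_sweep] show ?thesis
    using vert_orbit_translate[OF H_gens(2) w_vert] by simp
qed

text \<open>
  The walk \<open>es\<close> determines the class of \<open>\<gamma>\<close> in the fundamental group of the quotient, which is the
  \<open>k\<close>-th power of the class of the circuit. Coherence is carried along since both statements are proved
  by the same induction over the generation of \<open>\<gamma>\<close>.
\<close>
definition represents :: "('a \<Rightarrow> 'a) \<Rightarrow> ('a \<times> 'a) list \<Rightarrow> int \<Rightarrow> bool" where
  "represents \<gamma> es k \<longleftrightarrow> awalk w es (\<gamma> w) \<and> set es \<subseteq> sweep_arcs \<and> coherent 0 es 0 \<and>
     Y.homotopic (vert_orbit w) (vert_orbit w) (map arc_orbit es) (Y.loop_power \<beta> k)"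

lemma represents_one: "represents \<one>\<^bsub>aut_group X\<^esub> [] 0"
  using w_vert by (simp add: represents_def awalk_Nil_iff aut_one)

lemma represents_loop:
  assumes "represents \<gamma> es k" "\<gamma> \<in> H"
  shows "Y.awalk (vert_orbit w) (map arc_orbit es) (vert_orbit w)"
  using project_walk[of w es "\<gamma> w"] assms w_sweep vert_orbit_translate[OF assms(2) w_vert] by (auto simp: represents_def)

lemma represents_inv:
  assumes "represents \<gamma> es k" "\<gamma> \<in> H"
  shows "represents (inv\<^bsub>aut_group X\<^esub> \<gamma>) (act (inv\<^bsub>aut_group X\<^esub> \<gamma>) (rwalk es)) (- k)"
proof -
  let ?k = "inv\<^bsub>aut_group X\<^esub> \<gamma>"
  have es: "awalk w es (\<gamma> w)" "set es \<subseteq> sweep_arcs" "coherent 0 es 0"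
    "Y.homotopic (vert_orbit w) (vert_orbit w) (map arc_orbit es) (Y.loop_power \<beta> k)"
    using assms(1) by (auto simp: represents_def)
  note kH = H_inv[OF assms(2)]
  have "awalk (?k (\<gamma> w)) (act ?k (rwalk es)) (?k w)"
    by (rule awalk_act[OF H_aut[OF kH] awalk_rwalk[OF es(1)]])
  moreover have "?k (\<gamma> w) = w" using aut_inv(2)[OF H_aut[OF assms(2)] w_vert] .
  moreover have "map arc_orbit (act ?k (rwalk es)) = Y.rwalk (map arc_orbit es)"
    using project_act[OF kH rwalk_sweep[OF es(2)]] project_rwalk[OF es(2)] by simp
  moreover have "Y.homotopic (vert_orbit w) (vert_orbit w) (Y.rwalk (map arc_orbit es)) (Y.rwalk (Y.loop_power \<beta> k))"
    using Y.homotopic_rwalks[OF es(4) represents_loop[OF assms]] .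
  moreover have "Y.rwalk (Y.loop_power \<beta> k) = Y.loop_power \<beta> (- k)"
    using Y.awalk_arcs[OF \<beta>_loop] by (rule Y.rwalk_loop_power)
  moreover have "coherent 0 (act ?k (rwalk es)) 0"
    by (rule coherent_act[OF kH rwalk_sweep[OF es(2)] coherent_rwalk[OF es(3)]])
  ultimately show ?thesis
    using act_sweep[OF kH rwalk_sweep[OF es(2)]] by (simp add: represents_def)
qed

text \<open>
  The second walk is translated so that it starts at \<open>\<gamma> w\<close>; translation changes neither labels nor
  projection.
\<close>
lemma represents_mult:
  assumes "represents \<gamma> es k" "represents \<delta> es' k'" "\<gamma> \<in> H" "\<delta> \<in> H"
  shows "represents (\<gamma> \<otimes>\<^bsub>aut_group X\<^esub> \<delta>) (es @ act \<gamma> es') (k + k')"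
proof -
  have es: "awalk w es (\<gamma> w)" "set es \<subseteq> sweep_arcs" "coherent 0 es 0"
    "Y.homotopic (vert_orbit w) (vert_orbit w) (map arc_orbit es) (Y.loop_power \<beta> k)"
    and es': "awalk w es' (\<delta> w)" "set es' \<subseteq> sweep_arcs" "coherent 0 es' 0"
    "Y.homotopic (vert_orbit w) (vert_orbit w) (map arc_orbit es') (Y.loop_power \<beta> k')"
    using assms by (auto simp: represents_def)
  let ?b = "vert_orbit w"
  have b: "Y.awalk ?b [] ?b" using w_sweep by (auto simp: Y.awalk_Nil_iff verts_Y)
  have "awalk w (es @ act \<gamma> es') ((\<gamma> \<otimes>\<^bsub>aut_group X\<^esub> \<delta>) w)"
    using awalk_appendI[OF es(1) awalk_act[OF H_aut[OF assms(3)] es'(1)]]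
      aut_mult[OF H_aut[OF assms(3)] H_aut[OF assms(4)] w_vert] by simp
  moreover have "set (es @ act \<gamma> es') \<subseteq> sweep_arcs"
    using es(2) act_sweep[OF assms(3) es'(2)] by simp
  moreover have "coherent 0 (es @ act \<gamma> es') 0"
    using es(3) coherent_act[OF assms(3) es'(2,3)] by (auto simp: coherent_append)
  moreover have "Y.homotopic ?b ?b (map arc_orbit (es @ act \<gamma> es')) (Y.loop_power \<beta> (k + k'))"
  proof -
    have "Y.homotopic ?b ?b ([] @ map arc_orbit es @ map arc_orbit es') ([] @ Y.loop_power \<beta> k @ map arc_orbit es')"
      using Y.homotopic_append[OF es(4) b represents_loop[OF assms(2,4)]] .
    also have "Y.homotopic ?b ?b ([] @ Y.loop_power \<beta> k @ map arc_orbit es')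
        (Y.loop_power \<beta> k @ Y.loop_power \<beta> k')"
      using Y.homotopic_append[OF es'(4) Y.awalk_loop_power[OF \<beta>_loop] b] by simp
    also have "Y.homotopic ?b ?b \<dots> (Y.loop_power \<beta> (k + k'))"
      using Y.loop_power_add[OF \<beta>_loop] .
    finally show ?thesis using project_act[OF assms(3) es'(2)] by simp
  qed
  ultimately show ?thesis by (simp add: represents_def)
qed

lemma represents_h: "represents h p 1"
  using p_walk pq_sweep coherent_take_p[of "length p"] by (auto simp: represents_def)

text \<open>
  The walk goes from \<open>w\<close> along \<open>q\<close> to the fixed vertex \<open>v\<close> and returns along the image of \<open>q\<close> under
  \<open>g\<close>, so its projection is a walk followed by its reverse.
\<close>
lemma represents_g: "represents g (q @ act g (rwalk q)) 0"
proof -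
  have q: "set q \<subseteq> sweep_arcs" using pq_sweep by auto
  have "awalk v (act g (rwalk q)) (g w)"
    using awalk_act[OF g_aut awalk_rwalk[OF q_walk]] v_fixed by simp
  then have "awalk w (q @ act g (rwalk q)) (g w)" using awalk_appendI q_walk by blast
  moreover have "set (q @ act g (rwalk q)) \<subseteq> sweep_arcs"
    using q act_sweep[OF H_gens(1) rwalk_sweep[OF q]] by simp
  moreover have "coherent 0 (q @ act g (rwalk q)) 0"
    using coherent_take_q[of "length q"] coherent_act[OF H_gens(1) rwalk_sweep[OF q] coherent_rwalk]
    by (auto simp: coherent_append split: if_splits)
  moreover have "map arc_orbit (q @ act g (rwalk q)) = map arc_orbit q @ Y.rwalk (map arc_orbit q)"
    using project_act[OF H_gens(1) rwalk_sweep[OF q]] project_rwalk[OF q] by simp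
  moreover have "Y.homotopic (vert_orbit w) (vert_orbit w) (map arc_orbit q @ Y.rwalk (map arc_orbit q)) []"
    using Y.homotopic_rwalk[OF project_walk[OF q_walk q w_sweep]] .
  ultimately show ?thesis by (simp add: represents_def)
qed

lemma represents_exists: "\<gamma> \<in> H \<Longrightarrow> \<exists>es k. represents \<gamma> es k"
proof (induction rule: generate.induct)
  case one
  then show ?case using represents_one by blast
next
  case (incl f)
  then show ?case using represents_g represents_h by blast
next
  case (inv f)
  then show ?case using represents_inv[OF represents_g H_gens(1)] represents_inv[OF represents_h H_gens(2)] by blast
next
  case (eng f k)
  then show ?case using represents_mult by blast
qed

lemma coherent_walk_to:
  assumes "\<gamma> \<in> H" "i < length p + length q"
  shows "\<exists>es. awalk w es (\<gamma> (vert_lift i)) \<and> set es \<subseteq> sweep_arcs \<and> coherent 0 es i"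
proof -
  obtain es k where es: "represents \<gamma> es k" using represents_exists[OF assms(1)] by blast
  obtain es' where es': "awalk w es' (vert_lift i)" "set es' \<subseteq> sweep_arcs" "coherent 0 es' i"
    using coherent_walk_to_lift[OF assms(2)] by blast
  have "awalk w (es @ act \<gamma> es') (\<gamma> (vert_lift i))"
    using es awalk_act[OF H_aut[OF assms(1)] es'(1)]
    by (intro awalk_appendI) (auto simp: represents_def)
  moreover have "set (es @ act \<gamma> es') \<subseteq> sweep_arcs"
    using es act_sweep[OF assms(1) es'(2)] by (simp add: represents_def)
  moreover have "coherent 0 (es @ act \<gamma> es') i"
    using es coherent_act[OF assms(1) es'(2,3)] by (auto simp: represents_def coherent_append)
  ultimately show ?thesis by blast
qed

lemma vert_lift_sweep: "i < length p + length q \<Longrightarrow> vert_lift i \<in> fst ` sweep_arcs"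
  using pq_sweep snd_sweep nth_pq_sweep[of i] unfolding vert_lift_def by (auto simp: nth_append)

lemma tp_ends_verts:
  assumes "a \<in> arcs tp"
  shows "tail tp a \<in> verts tp" "head tp a \<in> verts tp"
proof -
  obtain i b where a: "a = (i, b)" "i < length p + length q"
    using assms by (cases a) (auto simp: tp_simps)
  have "Suc i mod length p < length p" using p_nonempty by simp
  then have "Suc i mod length p < length p + length q" by linarith
  then have "tadpole_from (length p) i < length p + length q" "tadpole_to (length p) i < length p + length q"
    using a(2) p_nonempty by (auto simp: tadpole_from_def tadpole_to_def)
  then show "tail tp a \<in> verts tp" "head tp a \<in> verts tp"
    using a(1) by (cases b; simp add: tp_simps)+
qed

text \<open>
  A swept vertex is the tail of a swept arc, and the projection of arcs to the quotient is compatible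
  with that of tadpole vertices.
\<close>
lemma sweep_vert_lift:
  assumes "x \<in> fst ` sweep_arcs"
  obtains \<gamma> i where "\<gamma> \<in> H" "i < length p + length q" "x = \<gamma> (vert_lift i)"
proof -
  obtain e where e: "e \<in> sweep_arcs" "x = fst e" using assms by auto
  obtain a where a: "a \<in> arcs tp" "fe a = arc_orbit e" using sweep_arc_lift[OF e(1)] by blast
  have "vert_orbit x = vert_orbit (fst (arc_lift a))" using a(2) e(2) fst_arc_orbit by metis
  then have "fv (tail tp a) = vert_orbit x" using tp_arc_ends[OF a(1)] by simp
  moreover have "tail tp a < length p + length q"
    using tp_ends_verts[OF a(1)] by (simp add: tp_simps)
  ultimately show ?thesis
    using that vert_orbit_eqD[OF _ sweep_verts_in_X[OF assms]] by metis
qed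

lemma sweep_walks:
  assumes "x \<in> fst ` sweep_arcs" "y \<in> fst ` sweep_arcs"
  shows "\<exists>es. awalk x es y \<and> set es \<subseteq> sweep_arcs"
proof -
  have *: "\<exists>es. awalk w es x \<and> set es \<subseteq> sweep_arcs" if "x \<in> fst ` sweep_arcs" for x
    using sweep_vert_lift[OF that] coherent_walk_to by metis
  obtain es es' where "awalk w es x" "set es \<subseteq> sweep_arcs" "awalk w es' y" "set es' \<subseteq> sweep_arcs"
    using *[OF assms(1)] *[OF assms(2)] by blast
  then have "awalk x (rwalk es @ es') y" "set (rwalk es @ es') \<subseteq> sweep_arcs"
    using awalk_rwalk awalk_appendI rwalk_sweep by (blast, simp)
  then show ?thesis by blast
qed

text \<open>
  If \<open>\<gamma>\<close> maps the lift of \<open>i\<close> to that of \<open>j\<close>, then there are coherent walks from \<open>w\<close> to this common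
  vertex, one ending with label \<open>i\<close> and one with label \<open>j\<close>. Together they form a closed walk from
  \<open>i\<close> to \<open>j\<close>; it cancels to the empty walk, and the empty walk is coherent only between
  identified labels.
\<close>
lemma identified_if_same_orbit:
  assumes "i < length p + length q" "j < length p + length q" "fv i = fv j"
  shows "identified i j"
proof -
  obtain \<gamma> where \<gamma>: "\<gamma> \<in> H" "vert_lift j = \<gamma> (vert_lift i)"
    using vert_orbit_eqD[OF assms(3)] sweep_verts_in_X[OF vert_lift_sweep[OF assms(2)]] by blast
  obtain es where es: "awalk w es (vert_lift j)" "coherent 0 es i"
    using coherent_walk_to[OF \<gamma>(1) assms(1)] \<gamma>(2) by metis
  obtain es' where es': "awalk w es' (vert_lift j)" "coherent 0 es' j"
    using coherent_walk_to_lift[OF assms(2)] by blast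
  have "coherent i (rwalk es @ es') j"
    using coherent_rwalk[OF es(2)] es'(2) by (auto simp: coherent_append)
  moreover have "(cancel prod.swap)\<^sup>*\<^sup>* (rwalk es @ es') []"
    using closed_walk_cancels[OF awalk_appendI[OF awalk_rwalk[OF es(1)] es'(1)]] .
  ultimately have "coherent i [] j" using coherent_cancels by blast
  then show ?thesis by simp
qed

lemma edge_identification_quotient:
  "edge_identification tp (tadpole_rev (length p) (length q)) Y r (\<lambda>i. fv i) (\<lambda>a. fe a)"
  unfolding edge_identification_def
proof (intro conjI ballI impI)
  show "(\<lambda>i. fv i) ` verts tp = verts Y"
  proof (intro equalityI subsetI)
    fix V assume "V \<in> verts Y"
    then obtain x where x: "x \<in> fst ` sweep_arcs" "V = vert_orbit x" by (auto simp: verts_Y)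
    from sweep_vert_lift[OF x(1)] obtain \<gamma> i where i: "\<gamma> \<in> H" "i < length p + length q" "x = \<gamma> (vert_lift i)"
      by blast
    then have "V = fv i" using x vert_orbit_translate[OF i(1) sweep_verts_in_X[OF vert_lift_sweep[OF i(2)]]] by simp
    with i show "V \<in> (\<lambda>i. fv i) ` verts tp" by (simp add: tp_simps)
  qed (use vert_lift_sweep in \<open>auto simp: tp_simps verts_Y\<close>)
  show "(\<lambda>a. fe a) ` arcs tp = arcs Y"
  proof (intro equalityI subsetI)
    fix E assume "E \<in> arcs Y"
    then show "E \<in> (\<lambda>a. fe a) ` arcs tp" using sweep_arc_lift by (force simp: arcs_Y)
  qed (use arc_lift_sweep in \<open>auto simp: arcs_Y\<close>)
next
  fix a assume a: "a \<in> arcs tp"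
  show "tail Y (fe a) = fv (tail tp a)" "head Y (fe a) = fv (head tp a)"
    using tp_arc_ends[OF a] by (simp_all add: tail_Y head_Y)
  show "fe (tadpole_rev (length p) (length q) a) = r (fe a)"
    using a tp_rev[OF a] arc_lift_sweep[OF a] by (simp add: tadpole_rev_def r_arc_orbit)
next
  fix i j assume "i \<in> verts tp" "j \<in> verts tp" "fv i = fv j"
  then show "equivclp (\<lambda>x y. \<exists>a\<in>arcs tp. \<exists>b\<in>arcs tp. fe a = fe b \<and> x = tail tp a \<and> y = tail tp b) i j"
    using identified_if_same_orbit[of i j] by (simp add: tp_simps identified_def)
qed

text \<open>
  A closed walk \<open>P\<close> at the base point lifts to a walk from \<open>w\<close> to some \<open>\<gamma> w\<close>. In the tree this is
  homotopic to the walk that represents \<open>\<gamma>\<close>, and the cancellations take place within the swept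
  subgraph, so they project to the quotient.
\<close>
lemma cyclic_quotient: "cyclic_fundamental_group Y r (vert_orbit w) \<beta>"
proof
  have w: "vert_orbit w \<in> verts Y" using w_sweep by (auto simp: verts_Y)
  show "Digraph_Component.connected Y"
  proof (rule Y.connectedI[OF w])
    fix V assume "V \<in> verts Y"
    then obtain x where x: "x \<in> fst ` sweep_arcs" "V = vert_orbit x" by (auto simp: verts_Y)
    then show "\<exists>P. Y.awalk (vert_orbit w) P V"
      using sweep_walks[OF w_sweep x(1)] project_walk[OF _ _ w_sweep] by blast
  qed
  show "Y.awalk (vert_orbit w) \<beta> (vert_orbit w)" by (rule \<beta>_loop)
  fix P assume P: "Y.awalk (vert_orbit w) P (vert_orbit w)"
  obtain es y where es: "awalk w es y" "set es \<subseteq> sweep_arcs" "map arc_orbit es = P" "vert_orbit w = vert_orbit y"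
    using lift_walk[OF P w_sweep] by blast
  have "y \<in> pverts X" using awalk_last_in_verts[OF es(1)] by simp
  then obtain \<gamma> where \<gamma>: "\<gamma> \<in> H" "y = \<gamma> w" using vert_orbit_eqD[OF es(4)] by blast
  obtain es' k where represents: "represents \<gamma> es' k" using represents_exists[OF \<gamma>(1)] by blast
  then have es': "awalk w es' y" "set es' \<subseteq> sweep_arcs" using \<gamma> by (auto simp: represents_def)
  have "(cancel prod.swap)\<^sup>*\<^sup>* (es @ rwalk es') []"
    using closed_walk_cancels[OF awalk_appendI[OF es(1) awalk_rwalk[OF es'(1)]]] .
  moreover have "set (es @ rwalk es') \<subseteq> sweep_arcs" using es(2) rwalk_sweep[OF es'(2)] by simp
  ultimately have "(cancel r)\<^sup>*\<^sup>* (map arc_orbit (es @ rwalk es')) (map arc_orbit [])"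
    by (rule project_cancels)
  then have "(cancel r)\<^sup>*\<^sup>* (P @ Y.rwalk (map arc_orbit es')) []"
    using es(3) project_rwalk[OF es'(2)] by simp
  then have "Y.homotopic (vert_orbit w) (vert_orbit w) (P @ Y.rwalk (map arc_orbit es')) []"
    by (rule Y.cancels_homotopic) (rule Y.awalk_appendI[OF P Y.awalk_rwalk[OF represents_loop[OF represents \<gamma>(1)]]])
  then have "Y.homotopic (vert_orbit w) (vert_orbit w) P (map arc_orbit es')"
    using Y.homotopicI_closed[OF P represents_loop[OF represents \<gamma>(1)]] by blast
  moreover have "Y.homotopic (vert_orbit w) (vert_orbit w) (map arc_orbit es') (Y.loop_power \<beta> k)"
    using represents by (simp add: represents_def)
  ultimately show "\<exists>k. Y.homotopic (vert_orbit w) (vert_orbit w) P (Y.loop_power \<beta> k)"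
    using Y.homotopic_trans by blast
qed

theorem quotient_of_tadpole:
  "cyclomatic_number Y r \<le> 1 \<and> (serre_tree Y r \<or> unicyclic Y r) \<and>
    (\<exists>fv fe. edge_identification (tadpole (length p) (length q))
         (tadpole_rev (length p) (length q)) Y r fv fe \<and>
       (unicyclic Y r \<longrightarrow>
          (\<forall>u P. circuit Y r P \<and> Y.awalk u P u \<longrightarrow>
             freely_homotopic Y r (u, P) (fv 0, map fe (tadpole_circuit (length p))) \<or>
             freely_homotopic Y r (u, rev (map r P)) (fv 0, map fe (tadpole_circuit (length p))))))"
proof -
  interpret C: cyclic_fundamental_group Y r "vert_orbit w" \<beta> by (rule cyclic_quotient)
  note ident = edge_identification_quotient
  have "finite (verts Y)" "finite (arcs Y)"
  proof -
    have "verts Y = (\<lambda>i. fv i) ` {..<length p + length q}"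
      "arcs Y = (\<lambda>a. fe a) ` ({..<length p + length q} \<times> UNIV)"
      using ident by (simp_all add: edge_identification_def tp_simps)
    then show "finite (verts Y)" "finite (arcs Y)" by auto
  qed
  then have "cyclomatic_number Y r \<le> 1" by (rule C.cyclomatic_number_le_1)
  moreover have "serre_tree Y r \<or> unicyclic Y r"
    by (rule C.tree_or_unicyclic[OF bidirected_Y])
  moreover have "vert_lift 0 = w"
    using walk_nth_ends(1)[OF p_walk p_nonempty] p_nonempty by (simp add: vert_lift_def)
  moreover have "map (\<lambda>a. fe a) (tadpole_circuit (length p)) = \<beta>"
    by (rule nth_equalityI) (auto simp: tadpole_circuit_def arc_lift_def nth_append)
  moreover note ident
  ultimately show ?thesis
    using C.circuit_freely_homotopic
    by (intro conjI exI[of _ "\<lambda>i. fv i"] exI[of _ "\<lambda>a. fe a"]) (auto simp: Y.rwalk_def)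
qed

end

section \<open>The minimal subtree of a tadpole of geodesics\<close>

context simplicial_tree
begin

lemma axis_image:
  assumes f: "f \<in> Aut" and x: "x \<in> pverts X"
  shows "f x \<in> pverts (axis X f) \<longleftrightarrow> x \<in> pverts (axis X f)"
  using dist_act[OF f x aut_vert[OF f x]] x aut_vert[OF f x] by (simp add: axis_def Let_def)

lemma axis_nonempty:
  assumes "x \<in> pverts X"
  obtains w where "w \<in> pverts (axis X f)"
proof -
  have "\<exists>v\<in>pverts X. dist v (f v) = translation_length X f"
    unfolding translation_length_def by (rule LeastI_ex) (use assms in blast)
  then show ?thesis using that by (auto simp: axis_def Let_def)
qed

lemma axis_arcsD:
  assumes "a \<in> parcs (axis X f)"
  shows "fst a \<in> pverts (axis X f)" "prod.swap a \<in> parcs (axis X f)"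
  using assms swap_in_parcs[of a] by (auto simp: axis_def Let_def)

lemma set_dist_attained:
  assumes "a \<in> M" "b \<in> N"
  obtains u w where "u \<in> M" "w \<in> N" "dist u w = set_dist X M N"
proof -
  have "\<exists>u\<in>M. \<exists>w\<in>N. dist u w = set_dist X M N"
    unfolding set_dist_def by (rule LeastI_ex) (use assms in blast)
  then show ?thesis using that by blast
qed

lemma set_dist_le: "u \<in> M \<Longrightarrow> w \<in> N \<Longrightarrow> set_dist X M N \<le> dist u w"
  unfolding set_dist_def by (rule Least_le) auto

lemma translates_conjugate:
  assumes f: "f \<in> Aut" and k: "k \<in> Aut" and s: "translates f x s"
  shows "translates (k \<otimes>\<^bsub>aut_group X\<^esub> f \<otimes>\<^bsub>aut_group X\<^esub> inv\<^bsub>aut_group X\<^esub> k) (k x) (act k s)"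
proof -
  interpret Aut: group "aut_group X" by (rule group_aut)
  let ?m = "k \<otimes>\<^bsub>aut_group X\<^esub> f \<otimes>\<^bsub>aut_group X\<^esub> inv\<^bsub>aut_group X\<^esub> k"
  have walk: "awalk x s (f x)" and ne: "s \<noteq> []" and red: "reduced (s @ act f s)"
    using s by (simp_all add: translates_def)
  have x: "x \<in> pverts X" using awalk_hd_in_verts[OF walk] by simp
  have arcs: "set s \<subseteq> parcs X" using walk_arcs[OF walk] .
  have k': "inv\<^bsub>aut_group X\<^esub> k \<in> Aut" and kf: "k \<otimes>\<^bsub>aut_group X\<^esub> f \<in> Aut"
    using f k by simp_all
  have "?m (k x) = k (f x)"
    using aut_mult[OF kf k' aut_vert[OF k x]] aut_mult[OF k f x] aut_inv(2)[OF k x] by simp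
  moreover have "act ?m (act k s) = act k (act f s)"
    using act_mult[OF kf k' act_arcs[OF k arcs]] act_mult[OF k f arcs] act_inv(1)[OF k arcs] by simp
  moreover have "reduced (act k (s @ act f s))"
    using arcs act_arcs[OF f arcs] red by (intro reduced_act[OF k]) auto
  moreover have "awalk (k x) (act k s) (k (f x))"
    by (rule awalk_act[OF k walk])
  ultimately show ?thesis
    using ne by (simp add: translates_def)
qed

end

context two_generator_group
begin

abbreviation (input) T where "T \<equiv> minimal_subtree X \<Gamma>"

lemma axis_subset_T:
  assumes "\<gamma> \<in> H" "hyperbolic X \<gamma>"
  shows "parcs (axis X \<gamma>) \<subseteq> parcs T"
  using assms by (auto simp: minimal_subtree_def Let_def)

text \<open>
  The conjugate of \<open>f\<close> by \<open>\<gamma>\<close> translates along the image of \<open>s\<close> under \<open>\<gamma>\<close>, which therefore lies on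
  the axis of a hyperbolic element.
\<close>
lemma T_arcs_translate:
  assumes "f \<in> H" "\<gamma> \<in> H" "translates f x s" "a \<in> set s"
  shows "map_prod \<gamma> \<gamma> a \<in> parcs T"
proof -
  let ?m = "\<gamma> \<otimes>\<^bsub>aut_group X\<^esub> f \<otimes>\<^bsub>aut_group X\<^esub> inv\<^bsub>aut_group X\<^esub> \<gamma>"
  have m: "?m \<in> H" using assms H_mult H_inv by blast
  note tr = translates_conjugate[OF H_aut[OF assms(1)] H_aut[OF assms(2)] assms(3)]
  have "hyperbolic X ?m" "set (act \<gamma> s) \<subseteq> parcs (axis X ?m)"
    using translates_hyperbolic(1,3)[OF H_aut[OF m] tr] .
  with axis_subset_T[OF m] assms(4) show ?thesis by auto
qed

lemma T_arcsD:
  assumes "a \<in> parcs T"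
  shows "fst a \<in> pverts T" "prod.swap a \<in> parcs T"
proof -
  obtain \<gamma> where "\<gamma> \<in> H" "hyperbolic X \<gamma>" "a \<in> parcs (axis X \<gamma>)"
    using assms by (auto simp: minimal_subtree_def Let_def)
  then show "fst a \<in> pverts T" "prod.swap a \<in> parcs T"
    using axis_arcsD[of a \<gamma>] by (auto simp: minimal_subtree_def Let_def simp del: swap_simp)
qed

text \<open>
  The minimality of the distance enters twice. The second vertex of \<open>q\<close> is not on the axis of \<open>h\<close>,
  so \<open>q\<close> does not backtrack against \<open>p\<close> at \<open>w\<close>, nor \<open>h q\<close> against \<open>p\<close> at \<open>h w\<close>. The last but one
  vertex of \<open>q\<close> is not fixed by \<open>g\<close>, so the walk does not backtrack against its image under \<open>h g\<close>
  at \<open>h u\<close>.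
\<close>
lemma bridge_translates:
  assumes p: "translates h w p" and q: "awalk w q u" "reduced q" "q \<noteq> []"
    and u: "u \<in> fixed_verts X g"
    and len: "length q = set_dist X (fixed_verts X g) (pverts (axis X h))"
  shows "translates (h \<otimes>\<^bsub>aut_group X\<^esub> g) u (rwalk q @ p @ act h q)"
proof -
  let ?f = "h \<otimes>\<^bsub>aut_group X\<^esub> g"
  let ?s = "rwalk q @ p @ act h q"
  have f: "?f \<in> Aut" using H_aut[OF H_mult[OF H_gens(2,1)]] .
  have uX: "u \<in> pverts X" "g u = u" using u by (auto simp: fixed_verts_def)
  have pw: "awalk w p (h w)" "p \<noteq> []" "reduced p" using p by (auto simp: translates_def reduced_append_iff)
  have qarcs: "set q \<subseteq> parcs X" using walk_arcs[OF q(1)] .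
  obtain a q1 where a: "q = a # q1" using q(3) by (cases q) auto
  obtain b q2 where b: "q = q2 @ [b]" using q(3) by (cases q rule: rev_cases) auto
  have aX: "a \<in> parcs X" using qarcs a by auto
  have bX: "b \<in> parcs X" using qarcs b by auto
  have off_axis: "snd a \<notin> pverts (axis X h)"
  proof
    assume "snd a \<in> pverts (axis X h)"
    then have "length q \<le> dist u (snd a)" using len set_dist_le[OF u] by simp
    moreover have "awalk u (rwalk q1) (snd a)"
      using q(1) a by (auto simp: awalk_Cons_iff intro: awalk_rwalk)
    ultimately show False using graph_dist_le a by fastforce
  qed
  have off_fixed: "fst b \<notin> fixed_verts X g"
  proof
    assume "fst b \<in> fixed_verts X g"
    moreover have "w \<in> pverts (axis X h)"
      using translates_hyperbolic(4)[OF h_aut p] pw by (cases p) (auto simp: awalk_Cons_iff)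
    ultimately have "length q \<le> dist (fst b) w" using len set_dist_le by simp
    moreover have "awalk (fst b) (rwalk q2) w"
      using q(1) b by (auto simp: awalk_append_split awalk_Cons_iff simp del: awalk_append_iff intro: awalk_rwalk)
    ultimately show False using graph_dist_le b by fastforce
  qed
  have on_axis: "fst c \<in> pverts (axis X h)" "snd c \<in> pverts (axis X h)" if "c \<in> set p" for c
    using translates_hyperbolic(4)[OF h_aut p] that by auto
  have parcs: "set p \<subseteq> parcs X" using walk_arcs[OF pw(1)] .
  have hq: "reduced (act h q)" "act h q \<noteq> []" "hd (act h q) = map_prod h h a" "last (act h q) = map_prod h h b"
  proof -
    have "hd q = a" "last q = b" using a b by (simp, metis last_snoc)
    then show "reduced (act h q)" "act h q \<noteq> []" "hd (act h q) = map_prod h h a"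
      "last (act h q) = map_prod h h b"
      using reduced_act[OF h_aut qarcs q(2)] hd_act[OF q(3)] last_act[OF q(3)] q(3) by simp_all
  qed
  have "reduced (p @ act h q)"
  proof -
    have "map_prod h h a \<noteq> prod.swap (last p)"
    proof
      assume "map_prod h h a = prod.swap (last p)"
      then have "h (snd a) = fst (last p)" by (metis snd_map_prod snd_swap)
      then have "h (snd a) \<in> pverts (axis X h)" using on_axis pw(2) by simp
      then show False using off_axis axis_image[OF h_aut arc_ends(2)[OF aX]] by simp
    qed
    then show ?thesis using hq pw by (simp add: reduced_append_iff)
  qed
  moreover have "hd (p @ act h q) \<noteq> prod.swap (last (rwalk q))"
    using on_axis(2)[of "hd p"] off_axis pw(2) a by auto
  moreover have "reduced (rwalk q)" using reduced_rwalk[of q] q(2) qarcs by simp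
  ultimately have red: "reduced ?s"
    by (subst reduced_append_iff) blast
  have "awalk u ?s (h u)"
    by (rule awalk_appendI[OF awalk_rwalk[OF q(1)] awalk_appendI[OF pw(1) awalk_act[OF h_aut q(1)]]])
  moreover have fu: "?f u = h u" using aut_mult[OF h_aut g_aut uX(1)] uX(2) by simp
  moreover have "reduced (act ?f ?s)"
    using red set_rwalk_arcs[of q] qarcs parcs act_arcs[OF h_aut qarcs] by (intro reduced_act[OF f]) auto
  moreover have "hd (act ?f ?s) \<noteq> prod.swap (last ?s)"
  proof
    assume "hd (act ?f ?s) = prod.swap (last ?s)"
    then have "map_prod ?f ?f (prod.swap b) = map_prod h h (prod.swap b)"
      using b hq(2,4) by (simp add: swap_map_prod)
    then have "?f (fst b) = h (fst b)" by (metis snd_map_prod snd_swap)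
    then have "g (fst b) = fst b"
      using aut_mult[OF h_aut g_aut arc_ends(1)[OF bX]] aut_inj[OF h_aut aut_vert[OF g_aut]]
        arc_ends(1)[OF bX] by simp
    with off_fixed arc_ends(1)[OF bX] show False by (simp add: fixed_verts_def)
  qed
  ultimately have "awalk u ?s (?f u)" "reduced (?s @ act ?f ?s)"
    using red by (simp_all only: reduced_append_iff[of ?s "act ?f ?s"] simp_thms)
  then show ?thesis
    using q(3) unfolding translates_def by (metis append_is_Nil_conv rwalk_simps(5))
qed

text \<open>
  The element \<open>h\<close> has \<open>p\<close> on its axis and, unless \<open>q\<close> is empty, the element \<open>h g\<close> is hyperbolic
  with \<open>q\<close> on its axis; conjugation gives all translates. Conversely, the swept subgraph is invariant and connected, so it contains
  every axis.
\<close>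
lemma minimal_subtree_tadpole:
  assumes ell: "elliptic X g" and hyp: "hyperbolic X h"
  obtains w v p q where "fundamental_tadpole X g h w v p q"
    "length p = translation_length X h"
    "length q = set_dist X (fixed_verts X g) (pverts (axis X h))"
    "fundamental_tadpole.sweep X g h p q = T"
proof -
  obtain x where x: "x \<in> fixed_verts X g" using ell by (auto simp: elliptic_def)
  obtain y where y: "y \<in> pverts (axis X h)"
    using axis_nonempty x by (auto simp: fixed_verts_def)
  obtain u w where u: "u \<in> fixed_verts X g" and w: "w \<in> pverts (axis X h)"
    and uw: "dist u w = set_dist X (fixed_verts X g) (pverts (axis X h))"
    using set_dist_attained[OF x y] by blast
  have uX: "u \<in> pverts X" "g u = u" and wX: "w \<in> pverts X"
    using u w by (auto simp: fixed_verts_def axis_def Let_def)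
  obtain p where p: "translates h w p" "length p = translation_length X h"
    using hyperbolic_translates[OF h_aut hyp w] by blast
  obtain q where q: "awalk w q u" "reduced q" "length q = dist w u"
    using reduced_walk_dist_exists[OF wX uX(1)] by blast
  have lq: "length q = set_dist X (fixed_verts X g) (pverts (axis X h))"
    using q(3) uw dist_commute[OF uX(1) wX] by simp
  interpret F: fundamental_tadpole X g h w u p q
    by unfold_locales (use p(1) q(1) uX(2) in \<open>simp_all add: translates_def\<close>)
  have forward: "F.sweep_arcs \<subseteq> parcs T"
  proof
    fix a assume "a \<in> F.sweep_arcs"
    then obtain \<gamma> c where c: "\<gamma> \<in> H" "a = map_prod \<gamma> \<gamma> c"
      "c \<in> set (p @ q) \<or> prod.swap c \<in> set (p @ q)" by (rule F.sweep_arcsE)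
    have in_T: "map_prod \<gamma> \<gamma> e \<in> parcs T" if e: "e \<in> set (p @ q)" for e
    proof (cases "e \<in> set p")
      case True
      then show ?thesis using T_arcs_translate[OF H_gens(2) c(1) p(1)] by blast
    next
      case False
      with e have eq: "e \<in> set q" "q \<noteq> []" by auto
      have "prod.swap e \<in> set (rwalk q @ p @ act h q)"
        using eq(1) by (simp add: set_rwalk del: swap_simp)
      from T_arcs_translate[OF H_mult[OF H_gens(2,1)] c(1)
          bridge_translates[OF p(1) q(1,2) eq(2) u lq] this]
      have "prod.swap (map_prod \<gamma> \<gamma> (prod.swap e)) \<in> parcs T" by (rule T_arcsD(2))
      then show ?thesis by (simp add: swap_map_prod)
    qed
    from c(3) show "a \<in> parcs T"
    proof
      assume "prod.swap c \<in> set (p @ q)"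
      from T_arcsD(2)[OF in_T[OF this]] show ?thesis by (simp add: c(2) swap_map_prod)
    qed (use in_T c(2) in blast)
  qed
  then have forward_verts: "fst ` F.sweep_arcs \<subseteq> pverts T"
    using T_arcsD(1) by blast
  have backward: "pverts (axis X \<gamma>) \<subseteq> fst ` F.sweep_arcs" "parcs (axis X \<gamma>) \<subseteq> F.sweep_arcs"
    if "\<gamma> \<in> H" "hyperbolic X \<gamma>" for \<gamma>
    using axis_in_invariant_subgraph[OF H_aut[OF that(1)] that(2) F.w_sweep, of F.sweep_arcs]
      F.sweep_verts_in_X F.sweep_verts_translate[OF that(1)] F.sweep_verts_translate[OF H_inv[OF that(1)]] F.sweep_walks
    by blast+
  have "pverts T \<subseteq> fst ` F.sweep_arcs" "parcs T \<subseteq> F.sweep_arcs"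
    using backward unfolding minimal_subtree_def Let_def by auto
  with forward forward_verts have "F.sweep = T"
    unfolding F.sweep_def by (intro pair_pre_digraph.equality) auto
  with that[OF F.fundamental_tadpole_axioms p(2) lq] show ?thesis by blast
qed

end

theorem theorem4p1:
  fixes X T :: "'a pair_pre_digraph"
    and g h :: "'a \<Rightarrow> 'a"
    and \<Gamma> :: "('a \<Rightarrow> 'a) monoid"
    and l d :: nat
    and Y :: "('a set, ('a \<times> 'a) set) pre_digraph"
    and r :: "('a \<times> 'a) set \<Rightarrow> ('a \<times> 'a) set"
  assumes "is_tree X" and "locally_finite X" and "cofinite_tree X"
    and "g \<in> carrier (aut_group X)" and "h \<in> carrier (aut_group X)"
    and "\<Gamma> = generated_group X {g, h}"
    and "T = minimal_subtree X \<Gamma>"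
    and "discrete_group X \<Gamma>" and "without_inversions X \<Gamma>" and "faithful_on \<Gamma> T"
    and "elliptic X g" and "hyperbolic X h"
    and "l = translation_length X h"
    and "d = set_dist X (fixed_verts X g) (pverts (axis X h))"
    and "Y = quotient_graph T \<Gamma>" and "r = quotient_rev T \<Gamma>"
  shows "cyclomatic_number Y r \<le> 1 \<and> (serre_tree Y r \<or> unicyclic Y r) \<and>
    (\<exists>fv fe. edge_identification (tadpole l d) (tadpole_rev l d) Y r fv fe \<and>
       (unicyclic Y r \<longrightarrow>
          (\<forall>u p. circuit Y r p \<and> pre_digraph.awalk Y u p u \<longrightarrow>
             freely_homotopic Y r (u, p) (fv 0, map fe (tadpole_circuit l)) \<or>
             freely_homotopic Y r (u, rev (map r p)) (fv 0, map fe (tadpole_circuit l)))))"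
proof -
  interpret two_generator_group X g h
    using assms(1,4,5,6,9)
    by unfold_locales (auto simp: without_inversions_def generated_group_def)
  obtain w v p q where tad: "fundamental_tadpole X g h w v p q"
    and len: "length p = l" "length q = d"
    and sweep: "fundamental_tadpole.sweep X g h p q = T"
    using minimal_subtree_tadpole[OF assms(11,12)] assms(6,7,13,14) by metis
  from fundamental_tadpole.quotient_of_tadpole[OF tad] show ?thesis
    unfolding sweep len assms(15,16) assms(6) .
qed

end
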